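(* For every integer $N\ge2$ there exist $a_j\in\mathbb{R}$, $b_j>0$, $j=1,\dots,N$, and a separated set $\Lambda\subset\mathbb{R}$ with $D^-(\Lambda)=N$, such that the generator $$\mathcal{G}(x)=\sum_{j=1}^N a_j\mathcal{H}(x-b_j)=\sum_{j=1}^N a_je^{b_j}\frac{e^x}{e^{2x}+e^{2b_j}},\qquad \mathcal{H}(x)=\frac{e^x}{e^{2x}+1},$$ has stable $\mathbb{Z}$-shifts and $\Lambda$ is not a uniqueness set for $V^\infty_{\mathbb{Z}}(\mathcal{G})$.
   Context: A countable set $\Lambda\subset\mathbb{R}$ is separated if $\inf_{\lambda\ne\lambda'}|\lambda-\lambda'|>0$; $D^-(\Lambda)=\lim_{R\to\infty}\inf_{x\in\mathbb{R}}\frac{\#(\Lambda\cap[x-R,x+R])}{2R}$. $V^\infty_{\mathbb{Z}}(\mathcal{G})$ is the space of all functions $f(x)=\sum_{n\in\mathbb{Z}}c_n\mathcal{G}(x-n)$, $x\in\mathbb{R}$, with $\{c_n\}\in l^\infty(\mathbb{Z})$. The set $\Lambda$ is not a uniqueness set for $V^\infty_{\mathbb{Z}}(\mathcal{G})$ if there is a non-trivial (not identically zero) $f\in V^\infty_{\mathbb{Z}}(\mathcal{G})$ that vanishes on $\Lambda$. The $\mathbb{Z}$-shifts of $\mathcal{G}$ are stable if for every $p\in[1,\infty]$ there are constants $C_1,C_2>0$ with $C_1\|\mathbf{c}\|_p\le\|\sum_{n\in\mathbb{Z}}c_n\mathcal{G}(\cdot-n)\|_{L^p(\mathbb{R})}\le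 C_2\|\mathbf{c}\|_p$ for all $\mathbf{c}=\{c_n\}\in l^p(\mathbb{Z})$. *)

theory Defs
  imports "HOL-Analysis.Analysis" "HOL-Probability.Essential_Supremum"
begin

text \<open>
  The $L^p(M)$ norm for $p \in [1,\infty]$, with value $\infty$ outside $L^p(M)$ (in particular
  for functions that are not measurable, which is also the convention of \<^const>\<open>esssup\<close>).
  Taking \<open>M = count_space UNIV\<close> gives the norm of $l^p$; its null sets are empty, so for
  $p = \infty$ the essential supremum is then the supremum.
\<close>

definition Lp_norm :: "'a measure \<Rightarrow> ennreal \<Rightarrow> ('a \<Rightarrow> complex) \<Rightarrow> ennreal" where
  "Lp_norm M p f =
    (if f \<notin> borel_measurable M then \<infinity>
     else if p = \<infinity> then esssup M (\<lambda>x. ennreal (norm (f x)))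
     else let I = (\<integral>\<^sup>+ x. ennreal (norm (f x) powr enn2real p) \<partial>M)
          in if I = \<infinity> then \<infinity> else ennreal (enn2real I powr (1 / enn2real p)))"

definition lp_seq :: "ennreal \<Rightarrow> (int \<Rightarrow> complex) set" where
  "lp_seq p = {c. Lp_norm (count_space UNIV) p c < \<infinity>}"

definition shift_term :: "(real \<Rightarrow> real) \<Rightarrow> (int \<Rightarrow> complex) \<Rightarrow> real \<Rightarrow> int \<Rightarrow> complex" where
  "shift_term G c x n = c n * of_real (G (x - of_int n))"

definition V_infty :: "(real \<Rightarrow> real) \<Rightarrow> (real \<Rightarrow> complex) set" where
  "V_infty G = {f. \<exists>c\<in>lp_seq \<infinity>. \<forall>x. (shift_term G c x has_sum f x) UNIV}"

text \<open>
  Convergence of the series is made explicit because \<^const>\<open>infsum\<close> is 0 on series that are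
  not summable. The constants may depend on $p$.
\<close>

definition stable_shifts :: "(real \<Rightarrow> real) \<Rightarrow> bool" where
  "stable_shifts G \<longleftrightarrow>
    (\<forall>p\<ge>1. \<exists>C1>0. \<exists>C2>0. \<forall>c\<in>lp_seq p.
       (\<forall>x. shift_term G c x summable_on UNIV) \<and>
       ennreal C1 * Lp_norm (count_space UNIV) p c
         \<le> Lp_norm lborel p (\<lambda>x. \<Sum>\<^sub>\<infinity>n. shift_term G c x n) \<and>
       Lp_norm lborel p (\<lambda>x. \<Sum>\<^sub>\<infinity>n. shift_term G c x n)
         \<le> ennreal C2 * Lp_norm (count_space UNIV) p c)"

definition uniqueness_set :: "real set \<Rightarrow> (real \<Rightarrow> complex) set \<Rightarrow> bool" where
  "uniqueness_set \<Lambda> V \<longleftrightarrow> \<not> (\<exists>f\<in>V. (\<exists>x. f x \<noteq> 0) \<and> (\<forall>x\<in>\<Lambda>. f x = 0))"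

definition separated :: "real set \<Rightarrow> bool" where
  "separated \<Lambda> \<longleftrightarrow>
    countable \<Lambda> \<and> 0 < (INF x\<in>\<Lambda>. INF y\<in>\<Lambda> - {x}. ereal \<bar>x - y\<bar>)"

text \<open>
  $D^-(\Lambda) = d$, as the existence of the limit together with its value. Meaningful for
  separated sets, whose intersections with bounded intervals are finite.
\<close>

definition has_lower_density :: "real set \<Rightarrow> real \<Rightarrow> bool" where
  "has_lower_density \<Lambda> d \<longleftrightarrow>
    ((\<lambda>R. INF x. real (card (\<Lambda> \<inter> {x - R..x + R})) / (2 * R)) \<longlongrightarrow> d) at_top"

definition H :: "real \<Rightarrow> real" where
  "H x = exp x / (exp (2 * x) + 1)"

end

theory Submission
  imports Defs
begin

text \<open>
  Put $h = 1/N$ and take $b_j = jh$, $a_j = (-1)^j$. A series of $\mathbb{Z}$-shifts of $G$ with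
  coefficients $c$ is then a series of $h\mathbb{Z}$-shifts of the single function $H$, with
  coefficients $d_{nN+j} = (-1)^j c_n$ for $1 \le j \le N$ (\<open>shift_series_eq_synth\<close>).
  For $c_n = (-1)^{nN}$ this is $f(x) = \sum_m (-1)^m H(x - mh)$. Since $H$ is even, reflection in a
  midpoint $(k + \frac12)h$ of two neighbouring nodes changes the sign of $f$, so $f$ vanishes at
  all these midpoints, which form a set of density $1/h = N$ (\<open>half_grid_not_uniqueness_set\<close>).

  The work lies in stability. The passage from $c$ to $d$ changes $l^p$ norms only by bounded
  factors, so it suffices that the $h\mathbb{Z}$-shifts of $H$ are stable (\<open>synth_stable\<close>). Let
  $f = \sum_m d_m H(\cdot - mh)$ and $s_m = H(mh)$. The samples $f(kh)$ are the convolution $s * d$,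
  and this convolution has an explicit summable inverse. Indeed $H(x) = 1/(2\cosh x)$, and
  \[ H(a) H(b) = \frac{\tanh a + \tanh b}{4 \sinh(a+b)} \]
  turns $\sum_j (-1)^j s_j s_{n-j}$ into a telescoping sum: it is $0$ for $n \neq 0$. With
  $\kappa_h = \sum_j (-1)^j s_j^2$ the sequence $(-1)^m s_m / \kappa_h$ is therefore inverse to $s$
  (\<open>synth_inversion\<close>), as soon as $\kappa_h \neq 0$.

  To see that $\kappa_h \neq 0$, let $P_h(z) = \sum_m s_m z^m$ for $|z| = 1$. Applying the inversion
  formula to $d_m = z^m$ gives $\kappa_h = P_h(z) P_h(-z)$. At $z = 1$ this reads
  $\kappa_h = P_h(1) P_h(-1)$. At $z = i$ both factors equal $P_{2h}(-1)$: the terms of odd index cancel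
  because $s$ is even. Thus $\kappa_h = P_{2h}(-1)^2$, and $P_{2h}(-1) \neq 0$ implies
  $P_h(-1) \neq 0$. For large $h$ the term $m = 0$ dominates $P_h(-1)$, and halving $h$ repeatedly
  reaches every $h > 0$ (\<open>kappa_nonzero\<close>).

  It remains to pass from samples to $L^p$ norms. Since $\log H$ is 1-Lipschitz, moving the
  sampling grid by $x$ changes the samples by at most $(e^{|x|} - 1)\, (s * |d|)$. For small $x$ this
  error is absorbed, because Young's inequality bounds $s * |d|$ in $l^p$ by $d$
  (\<open>young_grid_conv\<close>). Hence the $l^p$ norm of $d$ is bounded by that of the samples on $x + h\mathbb{Z}$,
  uniformly in $x \in [0, \delta]$, and integrating the $p$-th power over $x$ yields the $L^p$ norm of
  $f$ when $p < \infty$; for $p = \infty$ a single grid outside a null set is enough. The upper bound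
  follows from Young's inequality alone.
\<close>

section \<open>The function $1/(2\cosh x)$\<close>

lemma H_conv_cosh: "H x = 1 / (2 * cosh x)"
proof -
  have "exp (2 * x) = exp x * exp x" "1 = exp x * exp (- x)"
    by (simp_all add: mult_exp_exp)
  then have "exp (2 * x) + 1 = exp x * (2 * cosh x)"
    by (simp add: cosh_field_def distrib_left)
  then show ?thesis by (simp add: H_def)
qed

lemma H_pos [simp]: "H x > 0"
  and H_nonneg [simp]: "H x \<ge> 0"
  and H_minus [simp]: "H (- x) = H x"
  by (simp_all add: H_conv_cosh)

text \<open>
  The logarithm of $H$ is 1-Lipschitz, because $\cosh(u - x) \le e^{|x|} \cosh u$. Every comparison
  between different sampling grids rests on this bound.
\<close>

lemma H_translate_le: "H (x + y) \<le> exp \<bar>x\<bar> * H y"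
proof -
  have "cosh (x + y - x) \<le> exp \<bar>x\<bar> * cosh (x + y)"
  proof -
    have 1: "exp (y) \<le> exp \<bar>x\<bar> * exp (x + y)" "exp (-y) \<le> exp \<bar>x\<bar> * exp (-(x + y))"
      by (simp_all flip: exp_add)
    show ?thesis
      using 1 by (simp add: cosh_field_def distrib_left add_divide_distrib)
  qed
  then show ?thesis by (simp add: H_conv_cosh field_simps)
qed

lemma H_translate_diff_le: "\<bar>H (x + y) - H y\<bar> \<le> (exp \<bar>x\<bar> - 1) * H y"
proof -
  have "H y \<le> exp \<bar>x\<bar> * H (x + y)"
    using H_translate_le[of "-x" "x + y"] by simp
  then have "exp (- \<bar>x\<bar>) * H y \<le> H (x + y)"
    by (simp add: exp_minus field_simps)
  moreover have "(1 - exp (- \<bar>x\<bar>)) * H y \<le> (exp \<bar>x\<bar> - 1) * H y"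
  proof (rule mult_right_mono)
    have "exp (- \<bar>x\<bar>) + exp \<bar>x\<bar> \<ge> 2"
      using cosh_real_ge_1[of "\<bar>x\<bar>"] by (simp add: cosh_field_def)
    then show "1 - exp (- \<bar>x\<bar>) \<le> exp \<bar>x\<bar> - 1" by simp
  qed simp
  ultimately show ?thesis
    using H_translate_le[of x y] by (simp add: algebra_simps abs_le_iff)
qed

lemma H_le_exp: "H x \<le> exp (- \<bar>x\<bar>)"
proof -
  have "exp \<bar>x\<bar> \<le> 2 * cosh \<bar>x\<bar>" unfolding cosh_field_def by simp
  then have "exp \<bar>x\<bar> \<le> 2 * cosh x" by simp
  then show ?thesis by (simp add: H_conv_cosh exp_minus field_simps)
qed

text \<open>
  The addition theorem $\tanh a + \tanh b = \sinh(a+b) / (\cosh a \cosh b)$. It writes a product of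
  two values of $H$ as a difference of values of one function, and so makes the convolution
  of the samples of $H$ telescope.
\<close>

lemma H_mult_eq_tanh:
  assumes "a + b \<noteq> 0"
  shows "H a * H b = (tanh a - tanh (- b)) / (4 * sinh (a + b))"
proof -
  have "sinh (a + b) \<noteq> 0" using assms by simp
  moreover have "tanh a + tanh b = sinh (a + b) / (cosh a * cosh b)"
    by (simp add: tanh_def sinh_add add_divide_distrib)
  ultimately show ?thesis by (simp add: H_conv_cosh)
qed

lemma H_shift_eq: "H (x - b) = exp b * (exp x / (exp (2 * x) + exp (2 * b)))"
proof -
  have "exp x = exp (x - b) * exp b" "exp (2 * x) = exp (2 * (x - b)) * exp (2 * b)"
    by (simp_all flip: exp_add)
  moreover have "exp (2 * b) = exp b * exp b" by (simp flip: exp_add)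
  ultimately have *: "exp b * (exp x / (exp (2 * x) + exp (2 * b))) 
    = (exp b * exp b) * exp (x - b) / ((exp b * exp b) * (exp (2 * (x - b)) + 1))"
    by (simp only: distrib_left) (simp add: mult_ac)
  show ?thesis unfolding * H_def by simp
qed

section \<open>Sums over the integers\<close>

lemma has_sum_geometric_int:
  fixes q :: real
  assumes "0 \<le> q" "q < 1"
  shows "((\<lambda>m::int. q ^ nat \<bar>m\<bar>) has_sum (1 + 2 * q / (1 - q))) UNIV"
proof -
  have g: "(\<lambda>n. q ^ n) sums (1 / (1 - q))"
    using assms by (intro geometric_sums) auto
  have 1: "((\<lambda>n. q ^ n) has_sum (1 / (1 - q))) UNIV"
    by (rule sums_nonneg_imp_has_sum) (use assms g in auto)
  have 2: "((\<lambda>n. q * q ^ n) has_sum (q * (1 / (1 - q)))) UNIV"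
    by (rule has_sum_cmult_right[OF 1])
  have A: "((\<lambda>m::int. q ^ nat \<bar>m\<bar>) has_sum (1 / (1 - q))) (range int)"
    by (subst has_sum_reindex) (use 1 in \<open>auto simp: o_def\<close>)
  have B: "((\<lambda>m::int. q ^ nat \<bar>m\<bar>) has_sum (q * (1 / (1 - q)))) (range (\<lambda>n. - int (Suc n)))"
    by (subst has_sum_reindex) (use 2 in \<open>auto simp: o_def inj_on_def nat_add_distrib\<close>)
  have "m \<in> range int \<union> range (\<lambda>n. - int (Suc n))" for m
    by (cases m rule: int_cases) auto
  then have "range int \<union> range (\<lambda>n. - int (Suc n)) = UNIV" by blast
  moreover have "range int \<inter> range (\<lambda>n. - int (Suc n)) = {}" by auto
  moreover have "1 / (1 - q) + q * (1 / (1 - q)) = 1 + 2 * q / (1 - q)"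
    using assms by (simp add: field_simps)
  ultimately show ?thesis using has_sum_Un_disjoint[OF A B] by simp
qed

lemma infsum_int_shift: "(\<Sum>\<^sub>\<infinity>j::int. f (j - a)) = (\<Sum>\<^sub>\<infinity>j. f j)"
  by (rule infsum_reindex_bij_witness[where i = "\<lambda>j. j + a" and j = "\<lambda>j. j - a"]) auto

lemma infsum_int_reflect: "(\<Sum>\<^sub>\<infinity>j::int. f (a - j)) = (\<Sum>\<^sub>\<infinity>j. f j)"
  by (rule infsum_reindex_bij_witness[where i = "\<lambda>j. a - j" and j = "\<lambda>j. a - j"]) auto

lemma summable_int_shift: "(\<lambda>j::int. f (j - a)) summable_on UNIV \<longleftrightarrow> f summable_on UNIV"
  by (rule summable_on_reindex_bij_witness[where i = "\<lambda>j. j + a" and j = "\<lambda>j. j - a"]) auto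

lemma summable_int_reflect: "(\<lambda>j::int. f (a - j)) summable_on UNIV \<longleftrightarrow> f summable_on UNIV"
  by (rule summable_on_reindex_bij_witness[where i = "\<lambda>j. a - j" and j = "\<lambda>j. a - j"]) auto

lemma abs_powi_minus_one [simp]: "\<bar>(- 1 :: real) powi j\<bar> = 1"
  by (simp add: power_int_minus_left)

lemma summable_alternating:
  fixes f :: "int \<Rightarrow> real"
  assumes "f summable_on UNIV"
  shows "(\<lambda>j. (-1) powi j * f j) summable_on UNIV"
proof -
  have "(\<lambda>j. norm (f j)) summable_on UNIV" 
    using assms summable_on_iff_abs_summable_on_real by blast
  moreover have "norm ((-1) powi j * f j) = norm (f j)" for j
    by (simp add: abs_mult)
  ultimately have "(\<lambda>j. norm ((-1) powi j * f j)) summable_on UNIV" by simp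
  then show ?thesis by (rule abs_summable_summable)
qed

section \<open>Series of shifts of $H$ and their samples\<close>

definition grid :: "real \<Rightarrow> int \<Rightarrow> real" where
  "grid h m = H (of_int m * h)"

lemma grid_minus [simp]: "grid h (- m) = grid h m"
  by (simp add: grid_def)

lemma grid_pos [simp]: "grid h m > 0" "grid h m \<ge> 0" "\<bar>grid h m\<bar> = grid h m"
  by (simp_all add: grid_def)

text \<open>
  The samples decay geometrically, so all series below converge absolutely against
  bounded coefficients.
\<close>

lemma grid_le_geometric:
  assumes "h > 0"
  shows "grid h m \<le> exp (- h) ^ nat \<bar>m\<bar>"
proof -
  have "exp (- \<bar>of_int m * h\<bar>) = exp (- h) ^ nat \<bar>m\<bar>"
    using assms by (simp add: abs_mult exp_of_nat_mult [symmetric])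
  then show ?thesis using H_le_exp[of "of_int m * h"] by (simp add: grid_def)
qed

lemma summable_grid:
  assumes "h > 0"
  shows "grid h summable_on UNIV"
  by (rule summable_on_comparison_test[OF has_sum_imp_summable[OF has_sum_geometric_int[of "exp (- h)"]]])
    (use assms grid_le_geometric in auto)

lemma infsum_grid_pos:
  assumes "h > 0"
  shows "(\<Sum>\<^sub>\<infinity>m. grid h m) > 0"
proof -
  have "grid h 0 \<le> (\<Sum>\<^sub>\<infinity>m. grid h m)"
    using finite_sum_le_infsum[OF summable_grid[OF assms], of "{0}"] by simp
  then show ?thesis using grid_pos(1)[of h 0] by linarith
qed

lemma summable_H_grid:
  assumes "h > 0"
  shows "(\<lambda>m. H (x - of_int m * h)) summable_on UNIV"
proof (rule summable_on_comparison_test)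
  show "(\<lambda>m. exp \<bar>x\<bar> * grid h m) summable_on UNIV"
    by (intro summable_on_cmult_right summable_grid assms)
  show "H (x - of_int m * h) \<le> exp \<bar>x\<bar> * grid h m" for m
    using H_translate_le[of x "- of_int m * h"] by (simp add: grid_def)
qed auto

lemma abs_summable_bounded_mult:
  fixes d :: "'i \<Rightarrow> complex" and s :: "'i \<Rightarrow> real"
  assumes s: "s summable_on A" "\<And>i. s i \<ge> 0" and d: "\<And>i. norm (d i) \<le> K"
  shows "(\<lambda>i. norm (d i * of_real (s i))) summable_on A"
proof (rule summable_on_comparison_test)
  show "(\<lambda>i. K * s i) summable_on A" by (intro summable_on_cmult_right s)
  show "norm (d i * of_real (s i)) \<le> K * s i" for i
    using d[of i] s(2)[of i] by (auto simp: norm_mult intro: mult_right_mono)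
qed auto

text \<open>
  The synthesis operator of the $h\mathbb{Z}$-shifts of $H$.
\<close>

definition synth :: "real \<Rightarrow> (int \<Rightarrow> complex) \<Rightarrow> real \<Rightarrow> complex" where
  "synth h d x = (\<Sum>\<^sub>\<infinity>m. d m * of_real (H (x - of_int m * h)))"

lemma synth_abs_summable:
  fixes d :: "int \<Rightarrow> complex"
  assumes "h > 0" "\<And>m. norm (d m) \<le> K"
  shows "(\<lambda>m. norm (d m * of_real (H (x - of_int m * h)))) summable_on UNIV"
  using summable_H_grid[OF assms(1), of x] assms(2) by (intro abs_summable_bounded_mult) auto

lemma synth_has_sum:
  fixes d :: "int \<Rightarrow> complex"
  assumes "h > 0" "\<And>m. norm (d m) \<le> K"
  shows "((\<lambda>m. d m * of_real (H (x - of_int m * h))) has_sum synth h d x) UNIV"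
  unfolding synth_def using abs_summable_summable[OF synth_abs_summable[OF assms]] by simp

lemma grid_diff: "grid h (k - m) = H (of_int k * h - of_int m * h)"
  by (simp add: grid_def algebra_simps)

lemma summable_grid_mult:
  assumes "h > 0"
  shows "(\<lambda>j. grid h (j - a) * grid h (n - j)) summable_on UNIV"
proof (rule summable_on_comparison_test)
  show "(\<lambda>j. exp (of_int \<bar>n\<bar> * h) * grid h j) summable_on UNIV"
    by (intro summable_on_cmult_right summable_grid assms)
  fix j
  have "exp (- h) ^ nat \<bar>j - a\<bar> \<le> 1"
    using assms by (intro power_le_one) auto
  then have "grid h (j - a) \<le> 1" 
    using grid_le_geometric[OF assms, of "j - a"] by linarith
  moreover have "grid h (n - j) \<le> exp (of_int \<bar>n\<bar> * h) * grid h j"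
    using H_translate_le[of "of_int n * h" "- (of_int j * h)"] assms
    by (simp add: grid_diff abs_mult) (simp add: grid_def)
  ultimately show "grid h (j - a) * grid h (n - j) \<le> exp (of_int \<bar>n\<bar> * h) * grid h j"
    using mult_mono[of "grid h (j - a)" 1 "grid h (n - j)"] by simp
qed auto

section \<open>Recovering coefficients from the samples\<close>

lemma tanh_diff_eq:
  fixes h :: real
  assumes "h > 0" 
  shows "tanh (of_int j * h) - tanh (of_int (j - n) * h) 
    = 4 * sinh (of_int n * h) * (grid h j * grid h (n - j))"
proof (cases "n = 0")
  case False
  have "of_int j * h + of_int (n - j) * h = of_int n * h" by (simp add: algebra_simps)
  moreover have "of_int (j - n) * h = - (of_int (n - j) * h)" by (simp add: algebra_simps)
  ultimately show ?thesis
    using H_mult_eq_tanh[of "of_int j * h" "of_int (n - j) * h"] False assms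
    by (simp add: grid_def)
qed simp

lemma summable_tanh_diff:
  fixes h :: real
  assumes "h > 0"
  shows "(\<lambda>j. tanh (of_int j * h) - tanh (of_int (j - n) * h)) summable_on UNIV"
  unfolding tanh_diff_eq[OF assms] 
  using summable_grid_mult[OF assms, of 0] by (intro summable_on_cmult_right) simp

lemma powi_minus_one_diff: "((-1)::real) powi (a - b) = (-1) powi a * (-1) powi b"
  by (simp add: power_int_minus_left)

text \<open>
  Write $w_n$ for the sum. The difference $w_{n+1} - w_n$ is, after a shift of the index,
  $\pm w_1$, and $w_1 = 0$ because the reflection $j \mapsto 1 - j$ changes the sign of its terms. Working with
  differences by one step keeps every series absolutely convergent; the single sums
  $\sum_j (-1)^j \tanh(jh)$ do not converge.
\<close>

lemma alternating_tanh_diff_eq_0: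
  fixes h :: real
  assumes "h > 0"
  shows "(\<Sum>\<^sub>\<infinity>j. (-1) powi j * (tanh (of_int j * h) - tanh (of_int (j - n) * h))) = 0"
proof -
  define w where "w n j = (-1) powi j * (tanh (of_int j * h) - tanh (of_int (j - n) * h))" for n j
  have summ: "w n summable_on UNIV" for n
    unfolding w_def by (intro summable_alternating summable_tanh_diff assms)
  \<comment> \<open>Since tanh is odd, its increments are symmetric under the reflection, while the sign changes.\<close>
  have "w 1 (1 - j) = - w 1 j" for j
  proof -
    have "tanh (of_int (1 - j) * h) = - tanh (of_int (j - 1) * h)"
      by (simp add: algebra_simps flip: tanh_minus)
    then show ?thesis
      by (simp add: w_def powi_minus_one_diff)
  qed
  then have "infsum (w 1) UNIV = - infsum (w 1) UNIV"
    using infsum_int_reflect[of "w 1" 1] by (simp add: infsum_uminus)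
  then have w1: "infsum (w 1) UNIV = 0" by simp
  have step: "infsum (w (n + 1)) UNIV = infsum (w n) UNIV" for n
  proof -
    have *: "w (n + 1) j = w n j + (-1) powi n * w 1 (j - n)" for j
      by (simp add: w_def powi_minus_one_diff algebra_simps)
    have "infsum (w (n + 1)) UNIV = infsum (w n) UNIV + (-1) powi n * infsum (w 1) UNIV"
      unfolding *
      by (subst infsum_add) (use summ summable_int_shift[of "w 1"] infsum_int_shift[of "w 1"] in
        \<open>auto simp: infsum_cmult_right' intro!: summable_on_cmult_right\<close>)
    then show ?thesis using w1 by simp
  qed
  have "infsum (w n) UNIV = 0"
  proof (induction n rule: int_induct[where k = 0])
    case base show ?case by (simp add: w_def)
  next
    case (step1 i) then show ?case using step by simp
  next
    case (step2 i) then show ?case using step[of "i - 1"] by simp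
  qed
  then show ?thesis unfolding w_def .
qed

text \<open>
  The value of the convolution of $((-1)^j s_j)$ with $(s_j)$ at $0$; the inverse of the sampling
  map has to be normalized by it.
\<close>

definition kappa :: "real \<Rightarrow> real" where
  "kappa h = (\<Sum>\<^sub>\<infinity>j. (-1) powi j * (grid h j)\<^sup>2)"

text \<open>
  The sequences $(s_j)$ and $((-1)^j s_j)$ are convolution inverses of each other up to a factor.
  This is the identity $\mathrm{dn}(u + K)\, \mathrm{dn}(u) = k'$ for the Jacobi elliptic function
  dn, whose Fourier coefficients are values of the hyperbolic secant, read on coefficients.
\<close>

lemma alternating_grid_convolution:
  assumes "h > 0"
  shows "(\<Sum>\<^sub>\<infinity>j. (-1) powi j * (grid h j * grid h (n - j))) = (if n = 0 then kappa h else 0)"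
proof (cases "n = 0")
  case False
  have "4 * sinh (of_int n * h) * (\<Sum>\<^sub>\<infinity>j. (-1) powi j * (grid h j * grid h (n - j))) = 0"
    using alternating_tanh_diff_eq_0[OF assms, of n]
    unfolding tanh_diff_eq[OF assms]
    by (simp add: mult.left_commute flip: infsum_cmult_right')
  then show ?thesis using False assms by simp
qed (simp add: kappa_def power2_eq_square)

lemma summable_grid_double:
  assumes "h > 0"
  shows "(\<lambda>(k, m). grid h (n - k) * grid h (k - m)) summable_on UNIV \<times> UNIV"
proof (rule summable_on_SigmaI)
  fix k :: int
  show "((\<lambda>m. case (k, m) of (k, m) \<Rightarrow> grid h (n - k) * grid h (k - m)) has_sum
      (grid h (n - k) * (\<Sum>\<^sub>\<infinity>m. grid h m))) UNIV"
    using summable_grid[OF assms] infsum_int_reflect[of "grid h" k] summable_int_reflect[of "grid h" k]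
    by (auto simp: has_sum_iff infsum_cmult_right' intro!: summable_on_cmult_right)
next
  show "(\<lambda>k. grid h (n - k) * (\<Sum>\<^sub>\<infinity>m. grid h m)) summable_on UNIV"
    using summable_grid[OF assms] summable_int_reflect[of "grid h"]
    by (intro summable_on_cmult_left) auto
qed auto

text \<open>
  Associativity of convolution: the samples at $kh$ are $s * d$, and convolving with $((-1)^j s_j)$ undoes
  the convolution with $s$.
\<close>

lemma synth_inversion:
  assumes "h > 0" and d: "\<And>m. norm (d m) \<le> K"
  shows "(\<Sum>\<^sub>\<infinity>k. of_real ((-1) powi (n - k) * grid h (n - k)) * synth h d (of_int k * h)) 
    = of_real (kappa h) * d n"
proof -
  define F where "F k m = d m * of_real ((-1) powi (n - k) * (grid h (n - k) * grid h (k - m)))" for k m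
  have "(\<lambda>p. norm (case p of (k, m) \<Rightarrow> F k m)) summable_on UNIV \<times> UNIV"
  proof (rule summable_on_comparison_test)
    show "(\<lambda>p. K * (\<lambda>(k, m). grid h (n - k) * grid h (k - m)) p) summable_on UNIV \<times> UNIV"
      by (intro summable_on_cmult_right summable_grid_double assms)
    fix p :: "int \<times> int"
    show "norm (case p of (k, m) \<Rightarrow> F k m) \<le> K * (\<lambda>(k, m). grid h (n - k) * grid h (k - m)) p"
      using d[of "snd p"]
      by (auto simp: F_def norm_mult abs_mult norm_power_int split: prod.split intro!: mult_mono)
  qed auto
  then have summ: "(\<lambda>(k, m). F k m) summable_on UNIV \<times> UNIV"
    by (rule abs_summable_summable)
  have L: "of_real ((-1) powi (n - k) * grid h (n - k)) * synth h d (of_int k * h) = (\<Sum>\<^sub>\<infinity>m. F k m)" for k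
    unfolding synth_def F_def
    by (subst infsum_cmult_right'[symmetric]) (simp add: grid_diff mult_ac)
  have R: "(\<Sum>\<^sub>\<infinity>k. F k m) = (if m = n then of_real (kappa h) * d n else 0)" for m
  proof -
    have "(\<Sum>\<^sub>\<infinity>k. (-1) powi (n - k) * (grid h (n - k) * grid h (k - m)))
        = (\<Sum>\<^sub>\<infinity>j. (-1) powi j * (grid h j * grid h (n - m - j)))"
      using infsum_int_reflect[of "\<lambda>j. (-1) powi j * (grid h j * grid h (n - m - j))" n]
      by (simp add: algebra_simps)
    also have "\<dots> = (if n - m = 0 then kappa h else 0)"
      by (rule alternating_grid_convolution[OF assms(1)])
    finally have eq: "(\<Sum>\<^sub>\<infinity>k. (-1) powi (n - k) * (grid h (n - k) * grid h (k - m))) = \<dots>" .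
    have "(\<lambda>k. (-1) powi (n - k) * (grid h (n - k) * grid h (k - m))) summable_on UNIV"
    proof -
      have "(\<lambda>k. (-1) powi n * ((-1) powi k * (grid h (k - m) * grid h (n - k)))) summable_on UNIV"
        by (intro summable_on_cmult_right summable_alternating summable_grid_mult assms)
      then show ?thesis by (simp add: powi_minus_one_diff mult_ac)
    qed
    from has_sum_of_real[OF has_sum_infsum[OF this], where 'a = complex]
    have "(\<Sum>\<^sub>\<infinity>k. complex_of_real ((-1) powi (n - k) * (grid h (n - k) * grid h (k - m)))) 
      = of_real (if n - m = 0 then kappa h else 0)"
      unfolding eq by (rule infsumI)
    then show ?thesis
      unfolding F_def by (simp add: infsum_cmult_right' del: of_real_mult)
  qed
  have "(\<Sum>\<^sub>\<infinity>k. of_real ((-1) powi (n - k) * grid h (n - k)) * synth h d (of_int k * h)) 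
    = (\<Sum>\<^sub>\<infinity>m. \<Sum>\<^sub>\<infinity>k. F k m)"
    unfolding L by (rule infsum_swap_banach[OF summ])
  also have "\<dots> = (\<Sum>\<^sub>\<infinity>m\<in>{n}. of_real (kappa h) * d n)"
    unfolding R by (rule infsum_cong_neutral) auto
  finally show ?thesis by simp
qed
section \<open>The inversion constant does not vanish\<close>

text \<open>
  The Fourier series $P_h(z) = \sum_m s_m z^m$ of the samples of $H$, as a function on the unit circle.
\<close>

definition grid_symbol :: "real \<Rightarrow> complex \<Rightarrow> complex" where
  "grid_symbol h z = (\<Sum>\<^sub>\<infinity>m. z powi m * of_real (grid h m))"

lemma grid_symbol_summable:
  fixes z :: complex
  assumes "h > 0" "norm z = 1"
  shows "(\<lambda>m. z powi m * of_real (grid h m)) summable_on A"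
proof -
  have "(\<lambda>m. norm (z powi m * of_real (grid h m))) summable_on UNIV"
    using assms by (intro abs_summable_bounded_mult[where K = 1] summable_grid) (auto simp: norm_power_int)
  then have "(\<lambda>m. z powi m * of_real (grid h m)) summable_on UNIV" by (rule abs_summable_summable)
  then show ?thesis by (rule summable_on_subset_banach) simp
qed

text \<open>
  The samples of $H$ are even.
\<close>

lemma grid_symbol_inverse: "grid_symbol h (inverse z) = grid_symbol h z"
  using infsum_int_reflect[of "\<lambda>m. z powi m * of_real (grid h m)" 0]
  by (simp add: grid_symbol_def power_int_minus power_int_inverse)

text \<open>
  Characters are eigenvectors of the sampling map; evenness of the symbol replaces $1/z$ by $z$.
\<close>

lemma synth_character:
  assumes "norm z = 1"
  shows "synth h (\<lambda>m. z powi m) (of_int k * h) = z powi k * grid_symbol h z"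
proof -
  have nz: "z \<noteq> 0" using assms by auto
  have "synth h (\<lambda>m. z powi m) (of_int k * h) = (\<Sum>\<^sub>\<infinity>m. z powi (k - (k - m)) * of_real (grid h (k - m)))"
    by (simp add: synth_def grid_diff)
  also have "\<dots> = (\<Sum>\<^sub>\<infinity>m. z powi (k - m) * of_real (grid h m))"
    by (rule infsum_int_reflect[of "\<lambda>m. z powi (k - m) * of_real (grid h m)"])
  also have "\<dots> = z powi k * grid_symbol h (inverse z)"
    using nz by (simp add: grid_symbol_def power_int_diff power_int_inverse divide_inverse mult.assoc
        flip: infsum_cmult_right')
  finally show ?thesis by (simp add: grid_symbol_inverse)
qed

text \<open>
  This is the inversion formula for $d_m = z^m$ at $n = 0$; the alternating sign in that formula turns the second
  symbol into its value at $-z$.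
\<close>

lemma kappa_eq_symbol_product:
  assumes "h > 0" "norm z = 1"
  shows "of_real (kappa h) = grid_symbol h z * grid_symbol h (- z)"
proof -
  have nz: "z \<noteq> 0" using assms by auto
  have "of_real (kappa h) = (\<Sum>\<^sub>\<infinity>k. of_real ((-1) powi (0 - k) * grid h (0 - k)) * synth h (\<lambda>m. z powi m) (of_int k * h))"
    by (subst synth_inversion[where K = 1]) (use assms in \<open>auto simp: norm_power_int\<close>)
  also have "\<dots> = (\<Sum>\<^sub>\<infinity>k. grid_symbol h z * ((- z) powi k * of_real (grid h k)))"
    unfolding synth_character[OF assms(2)]
    by (intro infsum_cong) (auto simp: power_int_minus_left)
  finally show ?thesis by (simp add: infsum_cmult_right' grid_symbol_def)
qed

text \<open>
  Averaging $z = i$ and $z = -i$ cancels the terms of odd index. The terms of even index $2k$ carry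
  $i^{2k} = (-1)^k$, and $H(2kh)$ is a sample on the grid of width $2h$.
\<close>

lemma grid_symbol_imaginary_unit: 
  assumes "h > 0"
  shows "grid_symbol h \<i> = grid_symbol (2 * h) (- 1)"
proof -
  have summ: "(\<lambda>m. \<i> powi m * of_real (grid h m)) summable_on UNIV" 
       "(\<lambda>m. (-\<i>) powi m * of_real (grid h m)) summable_on UNIV"
    by (intro grid_symbol_summable assms; simp)+
  have "inverse \<i> = - \<i>" by simp
  then have "2 * grid_symbol h \<i> = grid_symbol h \<i> + grid_symbol h (- \<i>)"
    using grid_symbol_inverse[of h \<i>] by simp
  also have "\<dots> = (\<Sum>\<^sub>\<infinity>m. \<i> powi m * of_real (grid h m) + (-\<i>) powi m * of_real (grid h m))"
    unfolding grid_symbol_def using summ by (rule infsum_add[symmetric])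
  also have "\<dots> = (\<Sum>\<^sub>\<infinity>m\<in>range (\<lambda>k. 2 * k). 2 * (\<i> powi m * of_real (grid h m)))"
  proof (rule infsum_cong_neutral)
    fix m :: int assume "m \<in> UNIV - range (\<lambda>k. 2 * k)"
    then have "odd m" by (auto elim!: evenE)
    then show "\<i> powi m * of_real (grid h m) + (-\<i>) powi m * of_real (grid h m) = 0" by simp
  qed auto
  also have "\<dots> = (\<Sum>\<^sub>\<infinity>k. 2 * (\<i> powi (2 * k) * of_real (grid h (2 * k))))"
    by (subst infsum_reindex) (auto simp: inj_on_def o_def)
  also have "\<dots> = (\<Sum>\<^sub>\<infinity>k. 2 * ((-1) powi k * of_real (grid (2 * h) k)))"
  proof (intro infsum_cong)
    fix k :: int
    have "\<i> powi (2 * k) = (-1) powi k" using power_int_mult[of \<i> 2 k] by simp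
    then show "2 * (\<i> powi (2 * k) * of_real (grid h (2 * k))) = 2 * ((-1) powi k * of_real (grid (2 * h) k))"
      by (simp add: grid_def mult_ac)
  qed
  also have "\<dots> = 2 * grid_symbol (2 * h) (- 1)"
    by (simp add: grid_symbol_def infsum_cmult_right')
  finally show ?thesis by simp
qed

text \<open>
  The term of index $0$ is $\frac12$, and for $e^{-h} < \frac15$ the other terms add up to
  less than $\frac12$ in absolute value.
\<close>

lemma grid_symbol_minus_one_nonzero_coarse:
  assumes "h \<ge> 5"
  shows "grid_symbol h (- 1) \<noteq> 0"
proof
  assume zero: "grid_symbol h (- 1) = 0"
  have h: "h > 0" using assms by simp
  define q where "q = exp (- h)"
  have "exp h \<ge> 6" using exp_ge_add_one_self[of h] assms by linarith
  then have q: "0 < q" "q \<le> 1 / 6" 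
    by (simp_all add: q_def exp_minus field_simps)
  let ?f = "\<lambda>m. (- 1) powi m * complex_of_real (grid h m)"
  have geo: "(\<lambda>m::int. q ^ nat \<bar>m\<bar>) summable_on UNIV" "(\<Sum>\<^sub>\<infinity>m::int. q ^ nat \<bar>m\<bar>) = 1 + 2 * q / (1 - q)"
    using has_sum_geometric_int[of q] q by (auto simp: has_sum_iff)
  have n: "norm (?f m) = grid h m" for m by (simp add: norm_mult norm_power_int)
  have "infsum ?f (UNIV - {0}) = infsum ?f UNIV - infsum ?f {0}"
    by (intro infsum_Diff grid_symbol_summable h) auto
  also have "\<dots> = - 1 / 2"
    using zero by (simp add: grid_symbol_def grid_def H_def)
  finally have "1 / 2 = norm (infsum ?f (UNIV - {0}))" by simp
  also have "\<dots> \<le> (\<Sum>\<^sub>\<infinity>m\<in>UNIV - {0}. norm (?f m))"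
    by (rule norm_infsum_bound) (use summable_on_subset_banach[OF summable_grid[OF h]] in \<open>simp add: n\<close>)
  also have "\<dots> = (\<Sum>\<^sub>\<infinity>m\<in>UNIV - {0}. grid h m)" by (simp only: n)
  also have "\<dots> \<le> (\<Sum>\<^sub>\<infinity>m::int\<in>UNIV - {0}. q ^ nat \<bar>m\<bar>)"
    by (intro infsum_mono) (use summable_on_subset_banach[OF summable_grid[OF h]] summable_on_subset_banach[OF geo(1)] grid_le_geometric[OF h] in \<open>auto simp: q_def\<close>)
  also have "\<dots> = 2 * q / (1 - q)"
    by (subst infsum_Diff) (use geo in auto)
  also have "\<dots> < 1 / 2" using q by (simp add: field_simps)
  finally show False by simp
qed

lemma kappa_eq_symbol_square:
  assumes "h > 0"
  shows "of_real (kappa h) = (grid_symbol (2 * h) (- 1))\<^sup>2"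
proof -
  have "grid_symbol h (- \<i>) = grid_symbol h \<i>"
    using grid_symbol_inverse[of h \<i>] by simp
  then show ?thesis
    using kappa_eq_symbol_product[of h \<i>] grid_symbol_imaginary_unit[OF assms] assms
    by (simp add: power2_eq_square)
qed

text \<open>
  Induction on the number of doublings that bring $h$ into the range where the term of index $0$
  dominates. One step combines $\kappa_h = P_{2h}(-1)^2$ with $\kappa_h = P_h(1) P_h(-1)$.
\<close>

lemma grid_symbol_minus_one_nonzero:
  assumes "h > 0"
  shows "grid_symbol h (- 1) \<noteq> 0"
proof -
  have "h > 0 \<Longrightarrow> h * 2 ^ n \<ge> 5 \<Longrightarrow> grid_symbol h (- 1) \<noteq> 0" for n h
  proof (induction n arbitrary: h)
    case 0 then show ?case using grid_symbol_minus_one_nonzero_coarse by simp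
  next
    case (Suc n)
    then have "grid_symbol (2 * h) (- 1) \<noteq> 0" by (simp add: mult_ac)
    then have "complex_of_real (kappa h) \<noteq> 0"
      using kappa_eq_symbol_square[of h] Suc.prems by simp
    then show ?case
      using kappa_eq_symbol_product[of h 1] Suc.prems by auto
  qed
  moreover obtain n where "5 / h < 2 ^ n" using real_arch_pow[of 2 "5 / h"] by auto
  ultimately show ?thesis using assms by (simp add: field_simps) (meson less_imp_le)
qed

lemma kappa_nonzero:
  assumes "h > 0"
  shows "kappa h \<noteq> 0"
  using kappa_eq_symbol_square[OF assms] grid_symbol_minus_one_nonzero[of "2 * h"] assms by auto

section \<open>Young's inequality for the sampled kernel\<close>

text \<open>
  The graph of $t \mapsto t^r$ lies above its tangent at $w$; this is the weighted
  inequality of arithmetic and geometric means for $t^r$ and $w^r$ with weights $1/r$ and $1 - 1/r$.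
\<close>

lemma powr_tangent_le:
  fixes t w r :: real
  assumes "t \<ge> 0" "w > 0" "r \<ge> 1"
  shows "r * w powr (r - 1) * t \<le> t powr r + (r - 1) * w powr r"
proof (cases "t = 0")
  case False
  have "(t powr r) powr (1 / r) * (w powr r) powr (1 - 1 / r) \<le> 1 / r * t powr r + (1 - 1 / r) * w powr r"
    by (rule Youngs_inequality_0) (use assms False in auto)
  moreover have "r * (1 - 1 / r) = r - 1"
    using assms by (simp add: field_simps)
  ultimately have "t * w powr (r - 1) \<le> 1 / r * t powr r + (1 - 1 / r) * w powr r"
    using assms False by (simp add: powr_powr)
  then have "r * (t * w powr (r - 1)) \<le> r * (1 / r * t powr r + (1 - 1 / r) * w powr r)"
    using assms by (intro mult_left_mono) auto
  also have "\<dots> = t powr r + (r - 1) * w powr r"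
    using assms by (simp add: distrib_left flip: mult.assoc) (simp add: field_simps)
  finally show ?thesis by (simp add: mult_ac)
qed (use assms in auto)

text \<open>
  Jensen's inequality for a summable weight. Summing the tangent inequality at the weighted mean $w$ of $t$
  makes the linear terms cancel, so no limit of finite sums has to be taken.
\<close>

lemma jensen_infsum_powr:
  fixes a t :: "int \<Rightarrow> real"
  assumes a: "a summable_on UNIV" "\<And>i. a i \<ge> 0" and t: "\<And>i. 0 \<le> t i" "\<And>i. t i \<le> K" and r: "r \<ge> 1"
  shows "(\<Sum>\<^sub>\<infinity>i. a i * t i) powr r \<le> (\<Sum>\<^sub>\<infinity>i. a i) powr (r - 1) * (\<Sum>\<^sub>\<infinity>i. a i * t i powr r)"
    and "(\<lambda>i. a i * t i powr r) summable_on UNIV"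
proof -
  have "t i powr r \<le> K powr r" for i using t r by (intro powr_mono2) auto
  then have s1: "(\<lambda>i. a i * t i powr r) summable_on UNIV"
    by (intro summable_on_comparison_test[OF summable_on_cmult_left[OF a(1), of "K powr r"]])
      (use a in \<open>auto intro!: mult_left_mono\<close>)
  then show "(\<lambda>i. a i * t i powr r) summable_on UNIV" .
  have s2: "(\<lambda>i. a i * t i) summable_on UNIV"
    by (intro summable_on_comparison_test[OF summable_on_cmult_left[OF a(1), of K]])
      (use a t in \<open>auto intro!: mult_left_mono\<close>)
  define A where "A = (\<Sum>\<^sub>\<infinity>i. a i)"
  define T where "T = (\<Sum>\<^sub>\<infinity>i. a i * t i)"
  have T0: "T \<ge> 0" unfolding T_def by (intro infsum_nonneg) (use a t in auto)
  have A0: "A \<ge> 0" unfolding A_def by (intro infsum_nonneg) (use a in auto)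
  have TA: "T \<le> A * K" unfolding T_def A_def
    by (subst infsum_cmult_left'[symmetric], intro infsum_mono s2 summable_on_cmult_left a) (use a t in \<open>auto intro!: mult_left_mono\<close>)
  show "T powr r \<le> A powr (r - 1) * (\<Sum>\<^sub>\<infinity>i. a i * t i powr r)"
  proof (cases "T = 0")
    case True
    then show ?thesis using infsum_nonneg[of UNIV "\<lambda>i. a i * t i powr r"] a by simp
  next
    case False
    then have Tp: "T > 0" using T0 by simp
    with TA A0 have Ap: "A > 0" by (cases "A = 0") auto
    define w where "w = T / A"
    have w: "w > 0" using Tp Ap by (simp add: w_def)
    have Tw: "T = A * w" using Ap by (simp add: w_def)
    have "r * w powr (r - 1) * T = (\<Sum>\<^sub>\<infinity>i. r * w powr (r - 1) * (a i * t i))"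
      by (simp add: T_def infsum_cmult_right')
    also have "\<dots> \<le> (\<Sum>\<^sub>\<infinity>i. a i * t i powr r + (r - 1) * w powr r * a i)"
    proof (intro infsum_mono summable_on_add summable_on_cmult_right s1 s2 a)
      fix i
      show "r * w powr (r - 1) * (a i * t i) \<le> a i * t i powr r + (r - 1) * w powr r * a i"
        using mult_left_mono[OF powr_tangent_le[OF t(1)[of i] w r] a(2)[of i]]
        by (simp add: algebra_simps)
    qed
    also have "\<dots> = (\<Sum>\<^sub>\<infinity>i. a i * t i powr r) + (r - 1) * w powr r * A"
      unfolding A_def by (subst infsum_add) (auto simp: infsum_cmult_right' intro!: s1 summable_on_cmult_right a)
    finally have "r * w powr (r - 1) * T \<le> (\<Sum>\<^sub>\<infinity>i. a i * t i powr r) + (r - 1) * w powr r * A" .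
    moreover have "r * w powr (r - 1) * T = r * (w powr r * A)"
      using w by (simp add: Tw powr_diff)
    moreover have "(r - 1) * w powr r * A = r * (w powr r * A) - w powr r * A"
      by (simp add: algebra_simps)
    ultimately have *: "w powr r * A \<le> (\<Sum>\<^sub>\<infinity>i. a i * t i powr r)"
      by linarith
    have "T powr r = A powr (r - 1) * (w powr r * A)"
      using w Ap by (simp add: Tw powr_mult powr_diff)
    also have "\<dots> \<le> A powr (r - 1) * (\<Sum>\<^sub>\<infinity>i. a i * t i powr r)"
      using * by (intro mult_left_mono) auto
    finally show ?thesis .
  qed
qed

lemma nn_integral_count_space_int:
  fixes f :: "int \<Rightarrow> real"
  assumes "f summable_on UNIV" "\<And>i. f i \<ge> 0"
  shows "(\<integral>\<^sup>+ i. ennreal (f i) \<partial>count_space UNIV) = ennreal (\<Sum>\<^sub>\<infinity>i. f i)"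
proof -
  have "((\<lambda>n. f (int_decode n)) has_sum (\<Sum>\<^sub>\<infinity>i. f i)) UNIV"
    using assms has_sum_reindex_bij_betw[OF bij_int_decode, of f] by simp
  then have "(\<lambda>n. f (int_decode n)) sums (\<Sum>\<^sub>\<infinity>i. f i)" by (rule has_sum_imp_sums)
  then have "(\<Sum>n. ennreal (f (int_decode n))) = ennreal (\<Sum>\<^sub>\<infinity>i. f i)"
    by (intro suminf_ennreal_eq assms)
  then show ?thesis
    using nn_integral_bij_count_space[OF bij_int_decode, of "\<lambda>i. ennreal (f i)"]
    by (simp add: nn_integral_count_space_nat)
qed

text \<open>
  Convolution with the samples of $H$, for nonnegative real sequences.
\<close>

definition grid_conv :: "real \<Rightarrow> (int \<Rightarrow> real) \<Rightarrow> int \<Rightarrow> real" where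
  "grid_conv h u n = (\<Sum>\<^sub>\<infinity>m. grid h (n - m) * u m)"

abbreviation grid_sum :: "real \<Rightarrow> real" where
  "grid_sum h \<equiv> (\<Sum>\<^sub>\<infinity>m. grid h m)"

lemma grid_conv_summable:
  assumes "h > 0" "\<And>m. 0 \<le> u m" "\<And>m. u m \<le> K"
  shows "(\<lambda>m. grid h (n - m) * u m) summable_on UNIV"
  by (rule summable_on_comparison_test[where f = "\<lambda>m. grid h (n - m) * K"])
    (use assms summable_grid[OF assms(1)] summable_int_reflect[of "grid h" n] in \<open>auto intro!: mult_left_mono summable_on_cmult_left\<close>)

lemma grid_conv_nonneg:
  assumes "\<And>m. 0 \<le> u m"
  shows "grid_conv h u n \<ge> 0"
  unfolding grid_conv_def by (intro infsum_nonneg) (use assms in auto)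

lemma grid_conv_le:
  assumes "h > 0" "\<And>m. 0 \<le> u m" "\<And>m. u m \<le> K"
  shows "grid_conv h u n \<le> grid_sum h * K"
proof -
  have "grid_conv h u n \<le> (\<Sum>\<^sub>\<infinity>m. grid h (n - m) * K)"
    unfolding grid_conv_def
    by (intro infsum_mono grid_conv_summable[OF assms])
      (use assms summable_grid[OF assms(1)] summable_int_reflect[of "grid h" n] in \<open>auto intro!: mult_left_mono summable_on_cmult_left\<close>)
  also have "\<dots> = grid_sum h * K"
    by (simp add: infsum_cmult_left' infsum_int_reflect[of "grid h"])
  finally show ?thesis .
qed

lemma grid_conv_mono:
  assumes "h > 0" "\<And>m. 0 \<le> u m" "\<And>m. u m \<le> v m" "\<And>m. v m \<le> K"
  shows "grid_conv h u n \<le> grid_conv h v n"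
proof -
  have "0 \<le> v m" "u m \<le> K" for m using assms(2-4)[of m] by linarith+
  then show ?thesis
    unfolding grid_conv_def
    by (intro infsum_mono grid_conv_summable[where K = K]) (use assms in \<open>auto intro!: mult_left_mono\<close>)
qed

text \<open>
  Young's inequality $\|s * u\|_r \le \|s\|_1 \|u\|_r$ for $r < \infty$, stated for $r$-th powers.
  Jensen's inequality with weights $s_{n-m}$ bounds each term, and Tonelli's theorem sums the bounds.
\<close>

lemma young_grid_conv:
  assumes h: "h > 0" and u: "\<And>m. 0 \<le> u m" "\<And>m. u m \<le> K" and r: "r \<ge> 1"
  shows "(\<integral>\<^sup>+ n. ennreal (grid_conv h u n powr r) \<partial>count_space UNIV)
    \<le> ennreal (grid_sum h powr r) * (\<integral>\<^sup>+ m. ennreal (u m powr r) \<partial>count_space UNIV)"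
proof -
  let ?S = "grid_sum h"
  have S: "?S > 0" by (rule infsum_grid_pos[OF h])
  have shift: "(\<lambda>m. grid h (n - m)) summable_on UNIV" for n
    using summable_grid[OF h] summable_int_reflect[of "grid h" n] by simp
  have point: "ennreal (grid_conv h u n powr r) 
      \<le> ennreal (?S powr (r - 1)) * (\<integral>\<^sup>+ m. ennreal (grid h (n - m)) * ennreal (u m powr r) \<partial>count_space UNIV)" for n
  proof -
    note J = jensen_infsum_powr[of "\<lambda>m. grid h (n - m)" u K r, OF shift _ u r, simplified]
    have "ennreal (grid_conv h u n powr r) \<le> ennreal (?S powr (r - 1) * (\<Sum>\<^sub>\<infinity>m. grid h (n - m) * u m powr r))"
      using J(1) by (intro ennreal_leI) (simp add: grid_conv_def infsum_int_reflect[of "grid h"])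
    also have "\<dots> = ennreal (?S powr (r - 1)) * (\<integral>\<^sup>+ m. ennreal (grid h (n - m) * u m powr r) \<partial>count_space UNIV)"
      using J(2) by (subst nn_integral_count_space_int) (auto simp: ennreal_mult infsum_nonneg)
    finally show ?thesis by (simp add: ennreal_mult)
  qed
  have "(\<integral>\<^sup>+ n. ennreal (grid_conv h u n powr r) \<partial>count_space UNIV)
    \<le> (\<integral>\<^sup>+ n. ennreal (?S powr (r - 1)) * (\<integral>\<^sup>+ m. ennreal (grid h (n - m)) * ennreal (u m powr r) \<partial>count_space UNIV) \<partial>count_space UNIV)"
    by (intro nn_integral_mono point)
  also have "\<dots> = ennreal (?S powr (r - 1)) * (\<integral>\<^sup>+ n. (\<integral>\<^sup>+ m. ennreal (grid h (n - m)) * ennreal (u m powr r) \<partial>count_space UNIV) \<partial>count_space UNIV)"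
    by (rule nn_integral_cmult) simp
  also have "(\<integral>\<^sup>+ n. (\<integral>\<^sup>+ m. ennreal (grid h (n - m)) * ennreal (u m powr r) \<partial>count_space UNIV) \<partial>count_space UNIV)
     = (\<integral>\<^sup>+ m. (\<integral>\<^sup>+ n. ennreal (grid h (n - m)) * ennreal (u m powr r) \<partial>count_space UNIV) \<partial>count_space UNIV)"
    by (rule nn_integral_count_space_nn_integral) auto
  also have "\<dots> = (\<integral>\<^sup>+ m. ennreal ?S * ennreal (u m powr r) \<partial>count_space UNIV)"
  proof (intro nn_integral_cong)
    fix m :: int
    have "(\<integral>\<^sup>+ n. ennreal (grid h (n - m)) \<partial>count_space UNIV) = ennreal ?S"
      using summable_grid[OF h] summable_int_shift[of "grid h" m]
      by (subst nn_integral_count_space_int) (auto simp: infsum_int_shift)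
    then show "(\<integral>\<^sup>+ n. ennreal (grid h (n - m)) * ennreal (u m powr r) \<partial>count_space UNIV) = ennreal ?S * ennreal (u m powr r)"
      by (simp add: nn_integral_multc)
  qed
  also have "\<dots> = ennreal ?S * (\<integral>\<^sup>+ m. ennreal (u m powr r) \<partial>count_space UNIV)"
    by (rule nn_integral_cmult) simp
  also have "ennreal (?S powr (r - 1)) * (ennreal ?S * (\<integral>\<^sup>+ m. ennreal (u m powr r) \<partial>count_space UNIV))
    = ennreal (?S powr r) * (\<integral>\<^sup>+ m. ennreal (u m powr r) \<partial>count_space UNIV)"
    using S by (simp add: powr_diff flip: mult.assoc ennreal_mult)
  finally show ?thesis .
qed

section \<open>Coefficient bounds from shifted samples\<close>

lemma norm_synth_le:
  assumes h: "h > 0" and d: "\<And>m. norm (d m) \<le> K"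
  shows "norm (synth h d (x + of_int k * h)) \<le> exp \<bar>x\<bar> * grid_conv h (\<lambda>m. norm (d m)) k"
proof -
  have "norm (synth h d (x + of_int k * h)) \<le> (\<Sum>\<^sub>\<infinity>m. norm (d m * of_real (H (x + of_int k * h - of_int m * h))))"
    unfolding synth_def by (rule norm_infsum_bound[OF synth_abs_summable[OF h d]])
  also have "\<dots> \<le> (\<Sum>\<^sub>\<infinity>m. exp \<bar>x\<bar> * (grid h (k - m) * norm (d m)))"
  proof (intro infsum_mono synth_abs_summable[OF h d] summable_on_cmult_right grid_conv_summable[OF h, where K = K] d)
    fix m
    have "H (x + of_int k * h - of_int m * h) \<le> exp \<bar>x\<bar> * grid h (k - m)"
      using H_translate_le[of x "of_int k * h - of_int m * h"] by (simp add: grid_diff algebra_simps)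
    then have "norm (d m) * H (x + of_int k * h - of_int m * h) \<le> norm (d m) * (exp \<bar>x\<bar> * grid h (k - m))"
      by (intro mult_left_mono) auto
    then show "norm (d m * of_real (H (x + of_int k * h - of_int m * h))) \<le> exp \<bar>x\<bar> * (grid h (k - m) * norm (d m))"
      by (simp add: norm_mult mult_ac)
  qed auto
  finally show ?thesis by (simp add: infsum_cmult_right' grid_conv_def)
qed

lemma norm_synth_diff_le:
  assumes h: "h > 0" and d: "\<And>m. norm (d m) \<le> K"
  shows "norm (synth h d (x + of_int k * h) - synth h d (of_int k * h)) 
    \<le> (exp \<bar>x\<bar> - 1) * grid_conv h (\<lambda>m. norm (d m)) k"
proof -
  let ?D = "\<lambda>m. d m * of_real (H (x + of_int k * h - of_int m * h)) - d m * of_real (H (of_int k * h - of_int m * h))"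
  have D: "(?D has_sum synth h d (x + of_int k * h) - synth h d (of_int k * h)) UNIV"
    using has_sum_add[OF synth_has_sum[where d = d, OF h d, where x = "x + of_int k * h"] 
        has_sum_cmult_right[OF synth_has_sum[where d = d, OF h d, where x = "of_int k * h"], of "- 1"]] by simp
  have le: "norm (?D m) \<le> (exp \<bar>x\<bar> - 1) * (grid h (k - m) * norm (d m))" for m
  proof -
    have "\<bar>H (x + of_int k * h - of_int m * h) - H (of_int k * h - of_int m * h)\<bar> \<le> (exp \<bar>x\<bar> - 1) * grid h (k - m)"
      using H_translate_diff_le[of x "of_int k * h - of_int m * h"] by (simp add: grid_diff algebra_simps)
    then have "norm (d m) * \<bar>H (x + of_int k * h - of_int m * h) - H (of_int k * h - of_int m * h)\<bar> 
        \<le> norm (d m) * ((exp \<bar>x\<bar> - 1) * grid h (k - m))"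
      by (intro mult_left_mono) auto
    moreover have "norm (?D m) = norm (d m) * \<bar>H (x + of_int k * h - of_int m * h) - H (of_int k * h - of_int m * h)\<bar>"
      by (simp flip: right_diff_distrib of_real_diff add: norm_mult)
    ultimately show ?thesis by (simp add: mult_ac)
  qed
  have s: "(\<lambda>m. (exp \<bar>x\<bar> - 1) * (grid h (k - m) * norm (d m))) summable_on UNIV"
    by (intro summable_on_cmult_right grid_conv_summable[OF h, where K = K] d) auto
  have abs: "(\<lambda>m. norm (?D m)) summable_on UNIV"
    by (rule summable_on_comparison_test[OF s le]) auto
  have "norm (infsum ?D UNIV) \<le> (\<Sum>\<^sub>\<infinity>m. norm (?D m))" by (rule norm_infsum_bound[OF abs])
  also have "\<dots> \<le> (\<Sum>\<^sub>\<infinity>m. (exp \<bar>x\<bar> - 1) * (grid h (k - m) * norm (d m)))"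
    by (intro infsum_mono abs s le)
  finally show ?thesis
    using infsumI[OF D] by (simp add: infsum_cmult_right' grid_conv_def)
qed

lemma norm_coeff_le_samples:
  assumes h: "h > 0" and d: "\<And>m. norm (d m) \<le> K"
  shows "\<bar>kappa h\<bar> * norm (d n) \<le> grid_conv h (\<lambda>k. norm (synth h d (of_int k * h))) n"
proof -
  have bd: "norm (synth h d (of_int k * h)) \<le> grid_sum h * K" for k
    using norm_synth_le[where d = d, OF h d, where x = 0 and k = k] grid_conv_le[where u = "\<lambda>m. norm (d m)", OF h _ d, where n = k] by simp
  let ?F = "\<lambda>k. of_real ((-1) powi (n - k) * grid h (n - k)) * synth h d (of_int k * h)"
  have n: "norm (?F k) = grid h (n - k) * norm (synth h d (of_int k * h))" for k
    by (simp add: norm_mult abs_mult norm_power_int)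
  have "\<bar>kappa h\<bar> * norm (d n) = norm (infsum ?F UNIV)"
    unfolding synth_inversion[OF h d] by (simp add: norm_mult)
  also have "\<dots> \<le> (\<Sum>\<^sub>\<infinity>k. norm (?F k))"
    by (rule norm_infsum_bound) (unfold n, intro grid_conv_summable[OF h _ bd], simp)
  finally show ?thesis by (simp only: n grid_conv_def)
qed

text \<open>
  Samples on the shifted grid $x + h\mathbb{Z}$ control the coefficients up to an error that is small with $x$.
\<close>

lemma norm_coeff_le_offset_samples:
  assumes h: "h > 0" and d: "\<And>m. norm (d m) \<le> K"
  shows "\<bar>kappa h\<bar> * norm (d n) \<le> grid_conv h (\<lambda>k. norm (synth h d (x + of_int k * h)) 
      + (exp \<bar>x\<bar> - 1) * grid_conv h (\<lambda>m. norm (d m)) k) n"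
proof -
  have g: "grid_conv h (\<lambda>m. norm (d m)) k \<le> grid_sum h * K" for k
    by (rule grid_conv_le[OF h _ d]) simp
  have "grid_conv h (\<lambda>k. norm (synth h d (of_int k * h))) n \<le> grid_conv h (\<lambda>k. norm (synth h d (x + of_int k * h)) 
      + (exp \<bar>x\<bar> - 1) * grid_conv h (\<lambda>m. norm (d m)) k) n"
  proof (rule grid_conv_mono[OF h])
    fix k
    show "norm (synth h d (of_int k * h)) \<le> norm (synth h d (x + of_int k * h)) 
      + (exp \<bar>x\<bar> - 1) * grid_conv h (\<lambda>m. norm (d m)) k"
      using norm_synth_diff_le[where d = d, OF h d, where x = x and k = k] norm_triangle_ineq2[of "synth h d (of_int k * h)" "synth h d (x + of_int k * h)"]
      by (simp add: norm_minus_commute)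
    show "norm (synth h d (x + of_int k * h)) + (exp \<bar>x\<bar> - 1) * grid_conv h (\<lambda>m. norm (d m)) k
      \<le> exp \<bar>x\<bar> * (grid_sum h * K) + (exp \<bar>x\<bar> - 1) * (grid_sum h * K)"
      using norm_synth_le[where d = d, OF h d, where x = x and k = k] g[of k] by (intro add_mono mult_left_mono order_trans[OF norm_synth_le[OF h d]]) auto
  qed simp
  then show ?thesis using norm_coeff_le_samples[where d = d, OF h d, where n = n] by linarith
qed

lemma powr_add_le:
  fixes a b r :: real
  assumes "a \<ge> 0" "b \<ge> 0" "r \<ge> 1"
  shows "(a + b) powr r \<le> 2 powr r * (a powr r + b powr r)"
proof -
  have "(a + b) powr r \<le> (2 * max a b) powr r"
    using assms by (intro powr_mono2) auto
  also have "\<dots> = 2 powr r * max a b powr r" using assms by (simp add: powr_mult)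
  also have "\<dots> \<le> 2 powr r * (a powr r + b powr r)"
    by (intro mult_left_mono) (auto simp: max_def)
  finally show ?thesis .
qed

text \<open>
  The shift $x$ is so small that the error term in \<open>norm_coeff_le_offset_samples\<close> is at most
  a quarter of the left-hand side in every $l^p$ norm.
\<close>

definition good_offset :: "real \<Rightarrow> real \<Rightarrow> bool" where
  "good_offset h x \<longleftrightarrow> 4 * ((exp \<bar>x\<bar> - 1) * (grid_sum h)\<^sup>2) \<le> \<bar>kappa h\<bar>"

lemma good_offsets_near_0:
  assumes "h > 0"
  obtains \<delta> where "0 < \<delta>" "\<delta> \<le> 1" "\<delta> \<le> h" "\<And>x. 0 \<le> x \<Longrightarrow> x \<le> \<delta> \<Longrightarrow> good_offset h x"
proof -
  let ?S = "grid_sum h" and ?q = "\<bar>kappa h\<bar> / (4 * (grid_sum h)\<^sup>2)"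
  have S: "?S > 0" by (rule infsum_grid_pos[OF assms])
  have q: "?q > 0" using S kappa_nonzero[OF assms] by simp
  \<comment> \<open>The bound 1 makes $2/\delta \ge 1$; the bound $h$ keeps $[0, \delta)$ inside one period.\<close>
  define \<delta> where "\<delta> = min 1 (min h (ln (1 + ?q)))"
  have "good_offset h x" if "0 \<le> x" "x \<le> \<delta>" for x
  proof -
    have "exp x \<le> exp (ln (1 + ?q))" using that by (simp add: \<delta>_def)
    also have "\<dots> = 1 + ?q" using q by (intro exp_ln) linarith
    finally have "exp \<bar>x\<bar> - 1 \<le> ?q" using that by simp
    then show ?thesis using S by (simp add: good_offset_def field_simps)
  qed
  moreover have "ln (1 + ?q) > 0" using q by (intro ln_gt_zero) linarith
  ultimately show thesis using that[of \<delta>] assms by (simp add: \<delta>_def)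
qed

text \<open>
  With $L = \sup_m |d_m|$ the error term is at most $|\kappa_h| L / 4$, so it is absorbed once the
  supremum is taken on the left.
\<close>

lemma norm_coeff_le_sup_samples:
  assumes h: "h > 0" and d: "\<And>m. norm (d m) \<le> K" and x: "good_offset h x"
    and M: "\<And>k. norm (synth h d (x + of_int k * h)) \<le> M"
  shows "norm (d n) \<le> 2 * grid_sum h / \<bar>kappa h\<bar> * M"
proof -
  let ?S = "grid_sum h" and ?\<kappa> = "\<bar>kappa h\<bar>" and ?\<eta> = "exp \<bar>x\<bar> - 1"
  have S: "?S > 0" by (rule infsum_grid_pos[OF h])
  have \<kappa>: "?\<kappa> > 0" using kappa_nonzero[OF h] by simp
  have bdd: "bdd_above (range (\<lambda>m. norm (d m)))" 
    by (intro bdd_aboveI[where M = K]) (use d in auto)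
  define L where "L = (SUP m. norm (d m))"
  have L: "norm (d m) \<le> L" for m unfolding L_def by (intro cSUP_upper bdd) auto
  have M0: "M \<ge> 0" using M[of 0] norm_ge_zero order_trans by blast
  have step: "?\<kappa> * norm (d m) \<le> ?S * M + ?\<kappa> / 4 * L" for m
  proof -
    have L0: "L \<ge> 0" using L[of 0] norm_ge_zero order_trans by blast
    have g: "grid_conv h (\<lambda>m. norm (d m)) k \<le> ?S * L" for k
      by (rule grid_conv_le[OF h _ L]) simp
    have "?\<kappa> * norm (d m) \<le> grid_conv h (\<lambda>k. norm (synth h d (x + of_int k * h)) + ?\<eta> * grid_conv h (\<lambda>m. norm (d m)) k) m"
      by (rule norm_coeff_le_offset_samples[OF h L])
    also have "\<dots> \<le> ?S * (M + ?\<eta> * (?S * L))"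
      by (intro grid_conv_le h add_mono M mult_left_mono g add_nonneg_nonneg mult_nonneg_nonneg grid_conv_nonneg) auto
    also have "\<dots> = ?S * M + (?\<eta> * ?S\<^sup>2) * L"
      by (simp add: algebra_simps power2_eq_square)
    also have "\<dots> \<le> ?S * M + ?\<kappa> / 4 * L"
      using x L0 by (intro add_left_mono mult_right_mono) (auto simp: good_offset_def)
    finally show ?thesis .
  qed
  have "L \<le> (?S * M + ?\<kappa> / 4 * L) / ?\<kappa>"
    unfolding L_def using step \<kappa> by (intro cSUP_least) (auto simp flip: L_def simp: field_simps)
  then have "3 * (?\<kappa> * L) \<le> 4 * (?S * M)" using \<kappa> by (simp add: field_simps)
  moreover have "0 \<le> ?S * M" using S M0 by simp
  ultimately have "?\<kappa> * L \<le> 2 * (?S * M)" by linarith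
  then have "L \<le> 2 * ?S / ?\<kappa> * M" using \<kappa> by (simp add: field_simps)
  then show ?thesis using L[of n] by linarith
qed

text \<open>
  The analogue of \<open>norm_coeff_le_sup_samples\<close> for finite exponents: Young's inequality is applied
  twice to the error term. Absorbing that term requires $d \in l^r$.
\<close>

lemma sum_coeff_powr_le_samples:
  assumes h: "h > 0" and d: "\<And>m. norm (d m) \<le> K" and x: "good_offset h x" and r: "r \<ge> 1"
    and fin: "(\<integral>\<^sup>+ m. ennreal (norm (d m) powr r) \<partial>count_space UNIV) < \<infinity>"
  shows "(\<integral>\<^sup>+ m. ennreal (norm (d m) powr r) \<partial>count_space UNIV) \<le> 
    ennreal (2 * (2 * grid_sum h / \<bar>kappa h\<bar>) powr r) * (\<integral>\<^sup>+ k. ennreal (norm (synth h d (x + of_int k * h)) powr r) \<partial>count_space UNIV)"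
    (is "?D \<le> _ * ?F")
proof -
  let ?S = "grid_sum h" and ?\<kappa> = "\<bar>kappa h\<bar>" and ?\<eta> = "exp \<bar>x\<bar> - 1"
  let ?g = "grid_conv h (\<lambda>m. norm (d m))"
  let ?v = "\<lambda>k. norm (synth h d (x + of_int k * h)) + ?\<eta> * ?g k"
  have S: "?S > 0" by (rule infsum_grid_pos[OF h])
  have \<kappa>: "?\<kappa> > 0" using kappa_nonzero[OF h] by simp
  have \<eta>: "?\<eta> \<ge> 0" by simp
  have g: "?g k \<le> ?S * K" "0 \<le> ?g k" for k
    by (auto intro!: grid_conv_le[OF h _ d] grid_conv_nonneg)
  have v: "0 \<le> ?v k" "?v k \<le> exp \<bar>x\<bar> * (?S * K) + ?\<eta> * (?S * K)" for k
    using norm_synth_le[where d = d, OF h d, where x = x and k = k] g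
    by (auto intro!: add_mono mult_left_mono order_trans[OF norm_synth_le[OF h d]] add_nonneg_nonneg)
  have "ennreal (?\<kappa> powr r) * ?D = (\<integral>\<^sup>+ m. ennreal ((?\<kappa> * norm (d m)) powr r) \<partial>count_space UNIV)"
    using \<kappa> by (simp add: powr_mult ennreal_mult flip: nn_integral_cmult)
  also have "\<dots> \<le> (\<integral>\<^sup>+ m. ennreal (grid_conv h ?v m powr r) \<partial>count_space UNIV)"
    using r \<kappa> by (intro nn_integral_mono ennreal_leI powr_mono2 norm_coeff_le_offset_samples[OF h d]) auto
  also have "\<dots> \<le> ennreal (?S powr r) * (\<integral>\<^sup>+ k. ennreal (?v k powr r) \<partial>count_space UNIV)"
    by (rule young_grid_conv[OF h v r])
  also have "\<dots> \<le> ennreal (?S powr r) * (\<integral>\<^sup>+ k. ennreal (2 powr r) * (ennreal (norm (synth h d (x + of_int k * h)) powr r)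
      + ennreal (?\<eta> powr r) * ennreal (?g k powr r)) \<partial>count_space UNIV)"
  proof (intro mult_left_mono nn_integral_mono)
    fix k
    have "?v k powr r \<le> 2 powr r * (norm (synth h d (x + of_int k * h)) powr r + ?\<eta> powr r * ?g k powr r)"
      using powr_add_le[of "norm (synth h d (x + of_int k * h))" "?\<eta> * ?g k" r] r g[of k]
      by (simp add: powr_mult)
    then show "ennreal (?v k powr r) \<le> ennreal (2 powr r) * (ennreal (norm (synth h d (x + of_int k * h)) powr r)
      + ennreal (?\<eta> powr r) * ennreal (?g k powr r))"
      by (simp flip: ennreal_mult ennreal_plus)
  qed auto
  also have "\<dots> = ennreal (?S powr r) * (ennreal (2 powr r) * (?F + ennreal (?\<eta> powr r) * (\<integral>\<^sup>+ k. ennreal (?g k powr r) \<partial>count_space UNIV)))"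
    by (simp add: nn_integral_cmult nn_integral_add)
  also have "\<dots> \<le> ennreal (?S powr r) * (ennreal (2 powr r) * (?F + ennreal (?\<eta> powr r) * (ennreal (?S powr r) * ?D)))"
    by (intro mult_left_mono add_left_mono young_grid_conv[OF h _ d r]) auto
  also have "\<dots> = ennreal ((2 * ?S) powr r) * ?F + ennreal ((2 * (?\<eta> * ?S\<^sup>2)) powr r) * ?D"
    using S by (simp add: powr_mult ennreal_mult distrib_left power2_eq_square mult_ac)
  also have "\<dots> \<le> ennreal ((2 * ?S) powr r) * ?F + ennreal (?\<kappa> powr r / 2) * ?D"
  proof (intro add_left_mono mult_right_mono ennreal_leI)
    have "(2 * (?\<eta> * ?S\<^sup>2)) powr r \<le> (?\<kappa> / 2) powr r"
      using x r by (intro powr_mono2) (auto simp: good_offset_def)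
    also have "\<dots> = ?\<kappa> powr r / 2 powr r" by (simp add: powr_divide)
    also have "\<dots> \<le> ?\<kappa> powr r / 2"
      using r powr_mono[of 1 r 2] by (intro divide_left_mono) auto
    finally show "(2 * (?\<eta> * ?S\<^sup>2)) powr r \<le> ?\<kappa> powr r / 2" .
  qed auto
  finally have main: "ennreal (?\<kappa> powr r) * ?D \<le> ennreal ((2 * ?S) powr r) * ?F + ennreal (?\<kappa> powr r / 2) * ?D" .
  show ?thesis
  proof (cases "?F = \<infinity>")
    case True
    then show ?thesis using S \<kappa> by (simp add: ennreal_mult_eq_top_iff)
  next
    case False
    then obtain f where f: "?F = ennreal f" "f \<ge> 0" by (cases ?F) auto
    obtain e where e: "?D = ennreal e" "e \<ge> 0" using fin by (cases ?D) auto
    have "?\<kappa> powr r * e \<le> (2 * ?S) powr r * f + ?\<kappa> powr r / 2 * e"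
      using main f e by (simp flip: ennreal_mult ennreal_plus)
    then have "e \<le> 2 * ((2 * ?S) powr r / ?\<kappa> powr r) * f"
      using \<kappa> by (simp add: field_simps)
    then have "e \<le> 2 * (2 * ?S / ?\<kappa>) powr r * f"
      using S \<kappa> by (simp add: powr_divide)
    then show ?thesis unfolding f(1) e(1) using f e by (simp flip: ennreal_mult)
  qed
qed

section \<open>Comparing $L^p$ and $l^p$ norms\<close>

lemma one_le_enn2real:
  assumes "p \<ge> 1" "p \<noteq> \<infinity>"
  shows "enn2real p \<ge> 1"
  using enn2real_mono[of 1 p] assms by (simp add: top.not_eq_extremum)

text \<open>
  Comparison of two $L^p$ norms on different measure spaces from the inequality between the
  $p$-th powers, or between almost sure bounds if $p = \infty$.
\<close>

lemma Lp_norm_le: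
  assumes f: "f \<in> borel_measurable M" and g: "g \<in> borel_measurable M'" and p: "p \<ge> 1" and C: "C > 0"
    and fin: "p \<noteq> \<infinity> \<Longrightarrow> (\<integral>\<^sup>+ x. ennreal (norm (f x) powr enn2real p) \<partial>M)
      \<le> ennreal (C powr enn2real p) * (\<integral>\<^sup>+ x. ennreal (norm (g x) powr enn2real p) \<partial>M')"
    and top: "\<And>K. p = \<infinity> \<Longrightarrow> AE x in M'. norm (g x) \<le> K \<Longrightarrow> K \<ge> 0 \<Longrightarrow> AE x in M. norm (f x) \<le> C * K"
  shows "Lp_norm M p f \<le> ennreal C * Lp_norm M' p g"
proof (cases "p = \<infinity>")
  case True
  let ?E = "esssup M' (\<lambda>x. ennreal (norm (g x)))"
  have "esssup M (\<lambda>x. ennreal (norm (f x))) \<le> ennreal C * ?E"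
  proof (cases ?E)
    case (real K)
    have "AE x in M'. norm (g x) \<le> K"
      using esssup_AE[of "\<lambda>x. ennreal (norm (g x))" M'] unfolding real by (simp add: real(1))
    then have "AE x in M. norm (f x) \<le> C * K" using top True real by blast
    then have "AE x in M. ennreal (norm (f x)) \<le> ennreal C * ?E"
      by eventually_elim (use C real in \<open>simp flip: ennreal_mult\<close>)
    then show ?thesis using f by (intro esssup_I) auto
  next
    case top
    then show ?thesis using C by (simp add: ennreal_mult_top)
  qed
  then show ?thesis using True f g by (simp add: Lp_norm_def)
next
  case False
  define r where "r = enn2real p"
  have r: "r \<ge> 1" using one_le_enn2real[OF p False] by (simp add: r_def)
  let ?I = "\<integral>\<^sup>+ x. ennreal (norm (f x) powr r) \<partial>M" and ?J = "\<integral>\<^sup>+ x. ennreal (norm (g x) powr r) \<partial>M'"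
  have le: "?I \<le> ennreal (C powr r) * ?J" using fin[OF False] by (simp add: r_def)
  show ?thesis
  proof (cases ?J)
    case (real j)
    then have "?I \<le> ennreal (C powr r * j)" using le by (simp add: ennreal_mult)
    then obtain i where i: "?I = ennreal i" "i \<ge> 0" "i \<le> C powr r * j"
      using real by (cases ?I) (auto simp: top_unique)
    have "i powr (1 / r) \<le> (C powr r * j) powr (1 / r)"
      using i r by (intro powr_mono2) auto
    also have "\<dots> = C * j powr (1 / r)"
      using C r real by (simp add: powr_mult powr_powr)
    finally show ?thesis
      using False f g i real C by (simp add: Lp_norm_def Let_def flip: r_def ennreal_mult)
  next
    case top
    then show ?thesis using False g C by (simp add: Lp_norm_def Let_def ennreal_mult_top flip: r_def)
  qed
qed

lemma lp_seq_bounded: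
  assumes "c \<in> lp_seq p" "p \<ge> 1"
  obtains K where "\<And>n. norm (c n) \<le> K"
proof (cases "p = \<infinity>")
  case True
  let ?E = "esssup (count_space UNIV) (\<lambda>n. ennreal (norm (c n)))"
  have "?E < \<infinity>" using assms True by (simp add: lp_seq_def Lp_norm_def)
  then obtain K where K: "?E = ennreal K" "K \<ge> 0" by (cases ?E) auto
  have "AE n in count_space UNIV. ennreal (norm (c n)) \<le> ?E" by (rule esssup_AE)
  then have "norm (c n) \<le> K" for n using K by (simp add: AE_count_space)
  then show thesis using that by blast
next
  case False
  define r where "r = enn2real p"
  have r: "r \<ge> 1" using one_le_enn2real[OF assms(2) False] by (simp add: r_def)
  let ?I = "\<integral>\<^sup>+ n. ennreal (norm (c n) powr r) \<partial>count_space UNIV"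
  have "?I < \<infinity>"
    using assms False by (auto simp: lp_seq_def Lp_norm_def Let_def r_def top.not_eq_extremum split: if_splits)
  then obtain i where i: "?I = ennreal i" "i \<ge> 0" by (cases ?I) auto
  have "norm (c n) \<le> i powr (1 / r)" for n
  proof -
    have "ennreal (norm (c n) powr r) \<le> ?I"
      by (rule nn_integral_ge_point) simp
    then have "norm (c n) powr r \<le> i" using i by simp
    then have "(norm (c n) powr r) powr (1 / r) \<le> i powr (1 / r)" using r by (intro powr_mono2) auto
    then show ?thesis using r by (simp add: powr_powr)
  qed
  then show thesis using that by blast
qed

lemma lp_seq_finite:
  assumes "c \<in> lp_seq p" "p \<noteq> \<infinity>"
  shows "(\<integral>\<^sup>+ n. ennreal (norm (c n) powr enn2real p) \<partial>count_space UNIV) < \<infinity>"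
  using assms by (auto simp: lp_seq_def Lp_norm_def Let_def top.not_eq_extremum split: if_splits)

lemma measurable_H [measurable]: "H \<in> borel_measurable borel"
  unfolding H_def[abs_def] by measurable

lemma measurable_synth:
  assumes h: "h > 0" and d: "\<And>m. norm (d m) \<le> K"
  shows "synth h d \<in> borel_measurable borel"
proof -
  have "synth h d x = (\<Sum>n. d (int_decode n) * of_real (H (x - of_int (int_decode n) * h)))" for x
  proof -
    have "((\<lambda>n. d (int_decode n) * of_real (H (x - of_int (int_decode n) * h))) has_sum synth h d x) UNIV"
      using synth_has_sum[where d = d and x = x, OF h d]
        has_sum_reindex_bij_betw[OF bij_int_decode, of "\<lambda>m. d m * of_real (H (x - of_int m * h))"] by simp
    then show ?thesis using has_sum_imp_sums sums_unique by blast
  qed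
  then have "synth h d = (\<lambda>x. \<Sum>n. d (int_decode n) * of_real (H (x - of_int (int_decode n) * h)))" by blast
  also have "\<dots> \<in> borel_measurable borel" by measurable
  finally show ?thesis .
qed

text \<open>
  The translates of $[0, h)$ by $h\mathbb{Z}$ tile the line.
\<close>

lemma nn_integral_periodize:
  fixes g :: "real \<Rightarrow> ennreal"
  assumes h: "h > 0" and g [measurable]: "g \<in> borel_measurable borel"
  shows "(\<integral>\<^sup>+ x. indicator {0..<h} x * (\<integral>\<^sup>+ k. g (x + of_int k * h) \<partial>count_space UNIV) \<partial>lborel) = (\<integral>\<^sup>+ x. g x \<partial>lborel)"
proof -
  have "(\<integral>\<^sup>+ x. indicator {0..<h} x * (\<integral>\<^sup>+ k. g (x + of_int k * h) \<partial>count_space UNIV) \<partial>lborel)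
     = (\<integral>\<^sup>+ x. (\<integral>\<^sup>+ k. indicator {0..<h} x * g (x + of_int k * h) \<partial>count_space UNIV) \<partial>lborel)"
    by (simp add: nn_integral_cmult)
  also have "\<dots> = (\<integral>\<^sup>+ k. (\<integral>\<^sup>+ x. indicator {0..<h} x * g (x + of_int k * h) \<partial>lborel) \<partial>count_space UNIV)"
    by (rule nn_integral_count_space_nn_integral) auto
  also have "\<dots> = (\<integral>\<^sup>+ k. (\<integral>\<^sup>+ x. indicator {\<lfloor>x / h\<rfloor>} k * g x \<partial>lborel) \<partial>count_space UNIV)"
  proof (rule nn_integral_cong)
    fix k :: int
    have "(\<integral>\<^sup>+ x. indicator {0..<h} x * g (x + of_int k * h) \<partial>lborel)
       = (\<integral>\<^sup>+ x. indicator {0..<h} (- (of_int k * h) + x) * g x \<partial>lborel)"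
      using nn_integral_real_affine[of "\<lambda>x. indicator {0..<h} x * g (x + of_int k * h)" 1 "- (of_int k * h)"] by simp
    also have "\<dots> = (\<integral>\<^sup>+ x. indicator {\<lfloor>x / h\<rfloor>} k * g x \<partial>lborel)"
    proof (intro nn_integral_cong)
      fix x
      have "\<lfloor>x / h\<rfloor> = k \<longleftrightarrow> of_int k * h \<le> x \<and> x < of_int k * h + h"
        using h by (simp add: floor_eq_iff field_simps)
      then show "indicator {0..<h} (- (of_int k * h) + x) * g x = indicator {\<lfloor>x / h\<rfloor>} k * g x"
        by (auto simp: indicator_def)
    qed
    finally show "(\<integral>\<^sup>+ x. indicator {0..<h} x * g (x + of_int k * h) \<partial>lborel)
       = (\<integral>\<^sup>+ x. indicator {\<lfloor>x / h\<rfloor>} k * g x \<partial>lborel)" .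
  qed
  also have "\<dots> = (\<integral>\<^sup>+ x. (\<integral>\<^sup>+ k. indicator {\<lfloor>x / h\<rfloor>} k * g x \<partial>count_space UNIV) \<partial>lborel)"
  proof (rule nn_integral_count_space_nn_integral[symmetric])
    fix k :: int
    have "(\<lambda>x. indicator {\<lfloor>x / h\<rfloor>} k * g x) = (\<lambda>x. (if \<lfloor>x / h\<rfloor> = k then 1 else 0) * g x)"
      by (auto simp: fun_eq_iff indicator_def)
    also have "\<dots> \<in> borel_measurable lborel" by measurable
    finally show "(\<lambda>x. indicator {\<lfloor>x / h\<rfloor>} k * g x) \<in> borel_measurable lborel" .
  qed auto
  also have "\<dots> = (\<integral>\<^sup>+ x. g x \<partial>lborel)"
    by (simp add: nn_integral_multc)
  finally show ?thesis .
qed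

text \<open>
  Countably many translates of a null set do not cover an interval.
\<close>

lemma AE_good_translates:
  fixes P :: "real \<Rightarrow> bool"
  assumes ae: "AE x in lborel. P x" and [measurable]: "Measurable.pred borel P" and \<delta>: "\<delta> > 0"
  obtains x where "0 \<le> x" "x \<le> \<delta>" "\<And>k::int. P (x + of_int k * h)"
proof -
  have "AE x in lborel. P (of_int k * h + 1 * x)" for k :: int
    by (rule AE_borel_affine) (use ae in auto)
  then have all: "AE x in lborel. \<forall>k::int. P (x + of_int k * h)"
    by (subst AE_all_countable) (simp add: add.commute)
  have "\<exists>x. 0 \<le> x \<and> x \<le> \<delta> \<and> (\<forall>k::int. P (x + of_int k * h))"
  proof (rule ccontr)
    assume no: "\<not> ?thesis"
    from all have "AE x in lborel. x \<notin> {0..\<delta>}"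
      by eventually_elim (use no in auto)
    then have "emeasure lborel {0..\<delta>} = 0"
      by (subst (asm) AE_iff_measurable[where N = "{0..\<delta>}"]) auto
    then show False using \<delta> by simp
  qed
  then show thesis using that by blast
qed

text \<open>
  For $p < \infty$ the lower bound follows by averaging the bound of $d$ by the samples on $x + h\mathbb{Z}$
  over $x \in [0, \delta)$, and the upper bound by averaging the bound of these samples by $d$ over
  $x \in [0, h)$. For $p = \infty$ one $x \in [0, \delta]$ whose grid avoids the exceptional null set replaces
  the average.
\<close>

lemma synth_stable:
  assumes h: "h > 0" and p: "p \<ge> 1"
  obtains C1 C2 where "C1 > 0" "C2 > 0"
    "\<And>d. d \<in> lp_seq p \<Longrightarrow> ennreal C1 * Lp_norm (count_space UNIV) p d \<le> Lp_norm lborel p (synth h d)"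
    "\<And>d. d \<in> lp_seq p \<Longrightarrow> Lp_norm lborel p (synth h d) \<le> ennreal C2 * Lp_norm (count_space UNIV) p d"
proof -
  define r where "r = enn2real p"
  have r: "r \<ge> 1" if "p \<noteq> \<infinity>" using one_le_enn2real[OF p that] by (simp add: r_def)
  let ?S = "grid_sum h" and ?\<kappa> = "\<bar>kappa h\<bar>"
  have S: "?S > 0" by (rule infsum_grid_pos[OF h])
  have \<kappa>: "?\<kappa> > 0" using kappa_nonzero[OF h] by simp
  obtain \<delta> where \<delta>: "0 < \<delta>" "\<delta> \<le> 1" "\<delta> \<le> h" "\<And>x. 0 \<le> x \<Longrightarrow> x \<le> \<delta> \<Longrightarrow> good_offset h x"
    using good_offsets_near_0[OF h] by blast
  define C where "C = 2 * ?S / ?\<kappa>"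
  define B where "B = max 1 h * (exp h * ?S)"
  have C: "C > 0" using S \<kappa> by (simp add: C_def)
  have B: "B > 0" using S by (simp add: B_def)
  have lower: "Lp_norm (count_space UNIV) p d \<le> ennreal (2 / \<delta> * C) * Lp_norm lborel p (synth h d)" if d: "d \<in> lp_seq p" for d
  proof -
    obtain K where K: "\<And>n. norm (d n) \<le> K" using lp_seq_bounded[OF d p] by blast
    have meas [measurable]: "synth h d \<in> borel_measurable borel" by (rule measurable_synth[OF h K])
    show ?thesis
    proof (rule Lp_norm_le[OF _ _ p])
      show "2 / \<delta> * C > 0" using C \<delta> by simp
    next
      assume fin: "p \<noteq> \<infinity>"
      let ?D = "\<integral>\<^sup>+ m. ennreal (norm (d m) powr r) \<partial>count_space UNIV"
      let ?G = "\<lambda>x. \<integral>\<^sup>+ k. ennreal (norm (synth h d (x + of_int k * h)) powr r) \<partial>count_space UNIV"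
      have Dfin: "?D < \<infinity>" using lp_seq_finite[OF d fin] by (simp add: r_def)
      have "ennreal \<delta> * ?D = (\<integral>\<^sup>+ x. ?D * indicator {0..<\<delta>} x \<partial>lborel)"
        using \<delta> by (subst nn_integral_cmult_indicator) (auto simp: mult.commute)
      also have "\<dots> \<le> (\<integral>\<^sup>+ x. ennreal (2 * C powr r) * (indicator {0..<h} x * ?G x) \<partial>lborel)"
      proof (intro nn_integral_mono)
        fix x
        show "?D * indicator {0..<\<delta>} x \<le> ennreal (2 * C powr r) * (indicator {0..<h} x * ?G x)"
          using sum_coeff_powr_le_samples[OF h K \<delta>(4) r[OF fin] Dfin, of x] \<delta>
          by (auto simp: indicator_def C_def)
      qed
      also have "\<dots> = ennreal (2 * C powr r) * (\<integral>\<^sup>+ x. indicator {0..<h} x * ?G x \<partial>lborel)"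
      proof (rule nn_integral_cmult)
        have "?G \<in> borel_measurable lborel"
          unfolding nn_integral_bij_count_space[OF bij_int_decode, symmetric] nn_integral_count_space_nat
          by measurable
        then show "(\<lambda>x. indicator {0..<h} x * ?G x) \<in> borel_measurable lborel" by measurable
      qed
      also have "(\<integral>\<^sup>+ x. indicator {0..<h} x * ?G x \<partial>lborel) = (\<integral>\<^sup>+ x. ennreal (norm (synth h d x) powr r) \<partial>lborel)"
        by (rule nn_integral_periodize[OF h]) measurable
      finally have "ennreal \<delta> * ?D \<le> ennreal (2 * C powr r) * (\<integral>\<^sup>+ x. ennreal (norm (synth h d x) powr r) \<partial>lborel)" .
      then have "ennreal (1 / \<delta>) * (ennreal \<delta> * ?D) \<le> ennreal (1 / \<delta>) * (ennreal (2 * C powr r) * (\<integral>\<^sup>+ x. ennreal (norm (synth h d x) powr r) \<partial>lborel))"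
        by (intro mult_left_mono) auto
      then have "?D \<le> ennreal (2 / \<delta> * C powr r) * (\<integral>\<^sup>+ x. ennreal (norm (synth h d x) powr r) \<partial>lborel)"
        using \<delta> by (simp flip: mult.assoc ennreal_mult)
      also have "\<dots> \<le> ennreal ((2 / \<delta> * C) powr r) * (\<integral>\<^sup>+ x. ennreal (norm (synth h d x) powr r) \<partial>lborel)"
      proof (intro mult_right_mono ennreal_leI)
        \<comment> \<open>Moving the constant inside the power, since $2/\delta \ge 1$ and $r \ge 1$.\<close>
        have "2 / \<delta> \<ge> 1" using \<delta> by simp
        then have "2 / \<delta> \<le> (2 / \<delta>) powr r" 
          using powr_mono[OF r[OF fin], of "2 / \<delta>"] \<delta> by simp
        then have "2 / \<delta> * C powr r \<le> (2 / \<delta>) powr r * C powr r" by (intro mult_right_mono) auto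
        then show "2 / \<delta> * C powr r \<le> (2 / \<delta> * C) powr r" using C \<delta> by (simp only: powr_mult)
      qed simp
      finally show "(\<integral>\<^sup>+ m. ennreal (norm (d m) powr enn2real p) \<partial>count_space UNIV)
        \<le> ennreal ((2 / \<delta> * C) powr enn2real p) * (\<integral>\<^sup>+ x. ennreal (norm (synth h d x) powr enn2real p) \<partial>lborel)"
        by (simp add: r_def)
    next
      fix M :: real assume ae: "AE x in lborel. norm (synth h d x) \<le> M" and M0: "M \<ge> 0"
      obtain x where x: "0 \<le> x" "x \<le> \<delta>" "\<And>k::int. norm (synth h d (x + of_int k * h)) \<le> M"
        by (rule AE_good_translates[OF ae _ \<delta>(1), where h = h]) auto
      have "norm (d n) \<le> 2 / \<delta> * C * M" for n
      proof -
        have "norm (d n) \<le> C * M"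
          unfolding C_def by (rule norm_coeff_le_sup_samples[OF h K \<delta>(4) x(3)]) (use x in auto)
        also have "\<dots> \<le> 2 / \<delta> * (C * M)"
          using \<delta> C M0 mult_right_mono[of 1 "2 / \<delta>" "C * M"] by simp
        finally show ?thesis by (simp add: mult_ac)
      qed
      then show "AE n in count_space UNIV. norm (d n) \<le> 2 / \<delta> * C * M" by simp
    qed auto
  qed
  have upper: "Lp_norm lborel p (synth h d) \<le> ennreal B * Lp_norm (count_space UNIV) p d" if d: "d \<in> lp_seq p" for d
  proof -
    obtain K where K: "\<And>n. norm (d n) \<le> K" using lp_seq_bounded[OF d p] by blast
    have meas [measurable]: "synth h d \<in> borel_measurable borel" by (rule measurable_synth[OF h K])
    show ?thesis
    proof (rule Lp_norm_le[OF _ _ p B])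
      assume fin: "p \<noteq> \<infinity>"
      let ?D = "\<integral>\<^sup>+ m. ennreal (norm (d m) powr r) \<partial>count_space UNIV"
      let ?G = "\<lambda>x. \<integral>\<^sup>+ k. ennreal (norm (synth h d (x + of_int k * h)) powr r) \<partial>count_space UNIV"
      have "(\<integral>\<^sup>+ x. ennreal (norm (synth h d x) powr r) \<partial>lborel) = (\<integral>\<^sup>+ x. indicator {0..<h} x * ?G x \<partial>lborel)"
        by (rule nn_integral_periodize[OF h, symmetric]) measurable
      also have "\<dots> \<le> (\<integral>\<^sup>+ x. (ennreal ((exp h * ?S) powr r) * ?D) * indicator {0..<h} x \<partial>lborel)"
      proof (intro nn_integral_mono)
        fix x
        have "?G x \<le> ennreal ((exp h * ?S) powr r) * ?D" if x: "0 \<le> x" "x < h"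
        proof -
          have "?G x \<le> (\<integral>\<^sup>+ k. ennreal (exp h powr r) * ennreal (grid_conv h (\<lambda>m. norm (d m)) k powr r) \<partial>count_space UNIV)"
          proof (intro nn_integral_mono)
            fix k
            have "norm (synth h d (x + of_int k * h)) \<le> exp h * grid_conv h (\<lambda>m. norm (d m)) k"
              using x by (intro order_trans[OF norm_synth_le[OF h K]] mult_right_mono grid_conv_nonneg) auto
            then have "norm (synth h d (x + of_int k * h)) powr r \<le> (exp h * grid_conv h (\<lambda>m. norm (d m)) k) powr r"
              using r[OF fin] by (intro powr_mono2) auto
            then show "ennreal (norm (synth h d (x + of_int k * h)) powr r) \<le> ennreal (exp h powr r) * ennreal (grid_conv h (\<lambda>m. norm (d m)) k powr r)"
              by (simp add: powr_mult grid_conv_nonneg flip: ennreal_mult)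
          qed
          also have "\<dots> = ennreal (exp h powr r) * (\<integral>\<^sup>+ k. ennreal (grid_conv h (\<lambda>m. norm (d m)) k powr r) \<partial>count_space UNIV)"
            by (rule nn_integral_cmult) simp
          also have "\<dots> \<le> ennreal (exp h powr r) * (ennreal (?S powr r) * ?D)"
            by (intro mult_left_mono young_grid_conv[OF h _ K r[OF fin]]) auto
          finally show ?thesis using S by (simp add: powr_mult ennreal_mult mult.assoc)
        qed
        then show "indicator {0..<h} x * ?G x \<le> (ennreal ((exp h * ?S) powr r) * ?D) * indicator {0..<h} x"
          by (auto simp: indicator_def)
      qed
      also have "\<dots> = ennreal (h * (exp h * ?S) powr r) * ?D"
        using h by (subst nn_integral_cmult_indicator) (auto simp: ennreal_mult mult_ac)
      also have "\<dots> \<le> ennreal (B powr r) * ?D"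
      proof (intro mult_right_mono ennreal_leI)
        have "h \<le> max 1 h powr r" using powr_mono[OF r[OF fin], of "max 1 h"] by simp
        then have "h * (exp h * ?S) powr r \<le> max 1 h powr r * (exp h * ?S) powr r" by (intro mult_right_mono) auto
        then show "h * (exp h * ?S) powr r \<le> B powr r" using S by (simp add: B_def powr_mult)
      qed simp
      finally show "(\<integral>\<^sup>+ x. ennreal (norm (synth h d x) powr enn2real p) \<partial>lborel)
        \<le> ennreal (B powr enn2real p) * (\<integral>\<^sup>+ m. ennreal (norm (d m) powr enn2real p) \<partial>count_space UNIV)"
        by (simp add: r_def)
    next
      fix M :: real assume "AE n in count_space UNIV. norm (d n) \<le> M" and M0: "M \<ge> 0"
      then have M: "norm (d n) \<le> M" for n by (simp add: AE_count_space)
      have "norm (synth h d x) \<le> B * M" for x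
      proof -
        define y where "y = x - of_int \<lfloor>x / h\<rfloor> * h"
        have y: "0 \<le> y" "y \<le> h" 
          using floor_divide_lower[OF h, of x] floor_divide_upper[OF h, of x] by (auto simp: y_def algebra_simps)
        have "norm (synth h d (y + of_int \<lfloor>x / h\<rfloor> * h)) \<le> exp \<bar>y\<bar> * grid_conv h (\<lambda>m. norm (d m)) \<lfloor>x / h\<rfloor>"
          by (rule norm_synth_le[OF h M])
        also have "\<dots> \<le> exp h * (?S * M)"
          using y by (intro mult_mono grid_conv_le[OF h _ M] grid_conv_nonneg) auto
        also have "\<dots> \<le> max 1 h * (exp h * (?S * M))"
          using S M0 mult_right_mono[of 1 "max 1 h" "exp h * (?S * M)"] by simp
        finally show ?thesis by (simp add: y_def B_def mult_ac)
      qed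
      then show "AE x in lborel. norm (synth h d x) \<le> B * M" by simp
    qed auto
  qed
  have "ennreal (\<delta> / (2 * C)) * Lp_norm (count_space UNIV) p d \<le> Lp_norm lborel p (synth h d)" if "d \<in> lp_seq p" for d
  proof -
    have "ennreal (\<delta> / (2 * C)) * Lp_norm (count_space UNIV) p d \<le> ennreal (\<delta> / (2 * C)) * (ennreal (2 / \<delta> * C) * Lp_norm lborel p (synth h d))"
      by (intro mult_left_mono lower that) simp
    also have "\<dots> = Lp_norm lborel p (synth h d)"
      using \<delta> C by (simp flip: mult.assoc ennreal_mult)
    finally show ?thesis .
  qed
  moreover have "\<delta> / (2 * C) > 0" using \<delta> C by simp
  ultimately show thesis using that[OF _ B] upper by blast
qed

section \<open>The alternating generator\<close>

definition alternating_generator :: "nat \<Rightarrow> real \<Rightarrow> real" where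
  "alternating_generator N x = (\<Sum>j=1..N. (-1) ^ j * H (x - real j / real N))"

text \<open>
  The coefficients $d_{nN+j} = (-1)^j c_n$ for $1 \le j \le N$. Subtracting 1 from the index before
  dividing makes $j$ run from 1 to $N$, so that all shifts $b_j = j/N$ are positive.
\<close>

definition interleave :: "nat \<Rightarrow> (int \<Rightarrow> complex) \<Rightarrow> int \<Rightarrow> complex" where
  "interleave N c m = (-1) powi ((m - 1) mod int N + 1) * c ((m - 1) div int N)"

lemma norm_interleave: "norm (interleave N c m) = norm (c ((m - 1) div int N))"
  by (simp add: interleave_def norm_mult norm_power_int)

lemma shift_series_eq_synth:
  assumes N: "N > 0" and c: "\<And>n. norm (c n) \<le> K"
  shows "(shift_term (alternating_generator N) c x has_sum synth (1 / real N) (interleave N c) x) UNIV"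
proof -
  let ?f = "\<lambda>m. interleave N c m * of_real (H (x - of_int m * (1 / real N)))"
  let ?\<phi> = "\<lambda>(n, j). n * int N + int j"
  have "norm (interleave N c m) \<le> K" for m unfolding norm_interleave by (rule c)
  then have *: "(?f has_sum synth (1 / real N) (interleave N c) x) UNIV"
    using N by (intro synth_has_sum) auto
  have divmod: "(n * int N + int j - 1) div int N = n" "(n * int N + int j - 1) mod int N = int j - 1" 
    if "j \<in> {1..N}" for n j
  proof -
    have e: "n * int N + int j - 1 = (int j - 1) + n * int N" by simp
    have "(int j - 1) div int N = 0" "(int j - 1) mod int N = int j - 1" using that by auto
    then show "(n * int N + int j - 1) div int N = n" "(n * int N + int j - 1) mod int N = int j - 1"
      unfolding e using N by simp_all
  qed
  have bij: "bij_betw ?\<phi> (UNIV \<times> {1..N}) UNIV"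
  proof (rule bij_betw_byWitness[where f' = "\<lambda>m. ((m - 1) div int N, nat ((m - 1) mod int N) + 1)"])
    show "\<forall>p\<in>UNIV \<times> {1..N}. ((?\<phi> p - 1) div int N, nat ((?\<phi> p - 1) mod int N) + 1) = p"
      by (auto simp: divmod nat_diff_distrib)
    show "\<forall>m\<in>UNIV. ?\<phi> ((m - 1) div int N, nat ((m - 1) mod int N) + 1) = m"
      using N by auto
    show "(\<lambda>m. ((m - 1) div int N, nat ((m - 1) mod int N) + 1)) ` UNIV \<subseteq> UNIV \<times> {1..N}"
    proof clarsimp
      fix m :: int
      have "0 \<le> (m - 1) mod int N" "(m - 1) mod int N < int N" using N by simp_all
      then show "Suc (nat ((m - 1) mod int N)) \<le> N" by (simp add: Suc_le_eq nat_less_iff)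
    qed
  qed auto
  have "((\<lambda>p. ?f (?\<phi> p)) has_sum synth (1 / real N) (interleave N c) x) (UNIV \<times> {1..N})"
    using * has_sum_reindex_bij_betw[OF bij, of ?f] by blast
  then show ?thesis
  proof (rule has_sum_SigmaD)
    fix n :: int
    have "shift_term (alternating_generator N) c x n = (\<Sum>j\<in>{1..N}. ?f (?\<phi> (n, j)))"
      unfolding shift_term_def alternating_generator_def of_real_sum sum_distrib_left
    proof (intro sum.cong refl)
      fix j assume j: "j \<in> {1..N}"
      have "x - of_int (n * int N + int j) * (1 / real N) = x - of_int n - real j / real N"
        using N by (simp add: field_simps)
      then show "c n * of_real ((- 1) ^ j * H (x - of_int n - real j / real N)) = ?f (?\<phi> (n, j))"
        by (simp only: prod.case interleave_def divmod[OF j]) simp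
    qed
    then show "((\<lambda>j. ?f (?\<phi> (n, j))) has_sum shift_term (alternating_generator N) c x n) {1..N}"
      by (simp add: has_sum_finiteI)
  qed
qed

text \<open>
  Each $n$ is the quotient of exactly $N$ indices $m$.
\<close>

lemma nn_integral_count_space_blocks:
  fixes g :: "int \<Rightarrow> ennreal"
  assumes N: "N > 0"
  shows "(\<integral>\<^sup>+ m. g ((m - 1) div int N) \<partial>count_space UNIV) = of_nat N * (\<integral>\<^sup>+ n. g n \<partial>count_space UNIV)"
proof -
  have "(\<integral>\<^sup>+ m. g ((m - 1) div int N) \<partial>count_space UNIV)
    = (\<integral>\<^sup>+ m. (\<integral>\<^sup>+ n. g n * indicator {(m - 1) div int N} n \<partial>count_space UNIV) \<partial>count_space UNIV)"
    by (subst nn_integral_indicator_singleton) auto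
  also have "\<dots> = (\<integral>\<^sup>+ n. (\<integral>\<^sup>+ m. g n * indicator {(m - 1) div int N} n \<partial>count_space UNIV) \<partial>count_space UNIV)"
    by (rule nn_integral_count_space_nn_integral) auto
  also have "\<dots> = (\<integral>\<^sup>+ n. of_nat N * g n \<partial>count_space UNIV)"
  proof (rule nn_integral_cong)
    fix n :: int
    have block: "(m - 1) div int N = n \<longleftrightarrow> m \<in> {n * int N + 1..n * int N + int N}" for m
    proof
      assume "(m - 1) div int N = n"
      then have "m - 1 = n * int N + (m - 1) mod int N" by (metis div_mult_mod_eq)
      moreover have "0 \<le> (m - 1) mod int N" "(m - 1) mod int N < int N" using N by simp_all
      ultimately show "m \<in> {n * int N + 1..n * int N + int N}" by auto
    next
      assume m: "m \<in> {n * int N + 1..n * int N + int N}"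
      have "(m - 1 - n * int N) div int N = 0" using m by (intro div_pos_pos_trivial) auto
      moreover have "((m - 1 - n * int N) + n * int N) div int N = n + (m - 1 - n * int N) div int N" 
        using N by (intro div_mult_self1) simp
      ultimately show "(m - 1) div int N = n" by (simp only: diff_add_cancel add_0_right)
    qed
    have "g n * indicator {(m - 1) div int N} n = g n * indicator {n * int N + 1..n * int N + int N} m" for m
      using block[of m] by (cases "(m - 1) div int N = n") (simp_all only: indicator_def singleton_iff, simp_all)
    then show "(\<integral>\<^sup>+ m. g n * indicator {(m - 1) div int N} n \<partial>count_space UNIV) = of_nat N * g n"
      by (simp add: nn_integral_cmult mult.commute)
  qed
  also have "\<dots> = of_nat N * (\<integral>\<^sup>+ n. g n \<partial>count_space UNIV)" by (rule nn_integral_cmult) simp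
  finally show ?thesis .
qed

lemma Lp_norm_interleave:
  assumes N: "N > 0" and p: "p \<ge> 1"
  shows "Lp_norm (count_space UNIV) p c \<le> Lp_norm (count_space UNIV) p (interleave N c)"
    and "Lp_norm (count_space UNIV) p (interleave N c) \<le> ennreal (real N) * Lp_norm (count_space UNIV) p c"
proof -
  let ?C = "count_space (UNIV :: int set)"
  have blocks: "(\<integral>\<^sup>+ m. ennreal (norm (interleave N c m) powr r) \<partial>?C) 
      = ennreal (real N) * (\<integral>\<^sup>+ n. ennreal (norm (c n) powr r) \<partial>?C)" for r
    unfolding norm_interleave using nn_integral_count_space_blocks[OF N, of "\<lambda>n. ennreal (norm (c n) powr r)"] 
    by (simp add: ennreal_of_nat_eq_real_of_nat)
  have "Lp_norm ?C p c \<le> ennreal 1 * Lp_norm ?C p (interleave N c)"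
  proof (rule Lp_norm_le[OF _ _ p])
    show "(\<integral>\<^sup>+ n. ennreal (norm (c n) powr enn2real p) \<partial>?C)
      \<le> ennreal (1 powr enn2real p) * (\<integral>\<^sup>+ m. ennreal (norm (interleave N c m) powr enn2real p) \<partial>?C)"
      unfolding blocks using N mult_right_mono[of 1 "ennreal (real N)"] by simp
  next
    fix K assume "AE m in ?C. norm (interleave N c m) \<le> K"
    then have "norm (interleave N c (n * int N + 1)) \<le> K" for n by (simp add: AE_count_space)
    then have "norm (c n) \<le> K" for n using N by (simp add: norm_interleave)
    then show "AE n in ?C. norm (c n) \<le> 1 * K" by simp
  qed auto
  then show "Lp_norm ?C p c \<le> Lp_norm ?C p (interleave N c)" by simp
  show "Lp_norm ?C p (interleave N c) \<le> ennreal (real N) * Lp_norm ?C p c"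
  proof (rule Lp_norm_le[OF _ _ p])
    assume "p \<noteq> \<infinity>"
    then have "real N powr 1 \<le> real N powr enn2real p"
      using N one_le_enn2real[OF p] by (intro powr_mono) auto
    then show "(\<integral>\<^sup>+ m. ennreal (norm (interleave N c m) powr enn2real p) \<partial>?C)
      \<le> ennreal (real N powr enn2real p) * (\<integral>\<^sup>+ n. ennreal (norm (c n) powr enn2real p) \<partial>?C)"
      unfolding blocks using N by (intro mult_right_mono ennreal_leI) auto
  next
    fix K :: real assume "AE n in ?C. norm (c n) \<le> K" and K: "K \<ge> 0"
    then have "norm (interleave N c m) \<le> K" for m by (simp add: AE_count_space norm_interleave)
    moreover have "K \<le> real N * K" using N K mult_right_mono[of 1 "real N" K] by simp
    ultimately have "norm (interleave N c m) \<le> real N * K" for m using order_trans by blast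
    then show "AE m in ?C. norm (interleave N c m) \<le> real N * K" by simp
  qed (use N in auto)
qed

lemma alternating_generator_stable:
  assumes N: "N > 0"
  shows "stable_shifts (alternating_generator N)"
  unfolding stable_shifts_def
proof (intro allI impI)
  fix p :: ennreal assume p: "p \<ge> 1"
  let ?h = "1 / real N"
  obtain C1 C2 where C: "C1 > 0" "C2 > 0"
    "\<And>d. d \<in> lp_seq p \<Longrightarrow> ennreal C1 * Lp_norm (count_space UNIV) p d \<le> Lp_norm lborel p (synth ?h d)"
    "\<And>d. d \<in> lp_seq p \<Longrightarrow> Lp_norm lborel p (synth ?h d) \<le> ennreal C2 * Lp_norm (count_space UNIV) p d"
    using synth_stable[of ?h p] N p by auto
  show "\<exists>C1>0. \<exists>C2>0. \<forall>c\<in>lp_seq p.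
       (\<forall>x. shift_term (alternating_generator N) c x summable_on UNIV) \<and>
       ennreal C1 * Lp_norm (count_space UNIV) p c
         \<le> Lp_norm lborel p (\<lambda>x. \<Sum>\<^sub>\<infinity>n. shift_term (alternating_generator N) c x n) \<and>
       Lp_norm lborel p (\<lambda>x. \<Sum>\<^sub>\<infinity>n. shift_term (alternating_generator N) c x n)
         \<le> ennreal C2 * Lp_norm (count_space UNIV) p c"
  proof (rule exI[of _ C1], rule conjI[OF C(1)], rule exI[of _ "C2 * real N"], rule conjI, use C N in simp, rule ballI)
    fix c assume c: "c \<in> lp_seq p"
    obtain K where K: "\<And>n. norm (c n) \<le> K" using lp_seq_bounded[OF c p] by blast
    let ?d = "interleave N c"
    have eq: "(\<lambda>x. \<Sum>\<^sub>\<infinity>n. shift_term (alternating_generator N) c x n) = synth ?h ?d"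
      using shift_series_eq_synth[where c = c, OF N K] by (auto simp: fun_eq_iff intro!: infsumI)
    note norms = Lp_norm_interleave[OF N p, of c]
    have d: "?d \<in> lp_seq p"
      using c norms(2) by (auto simp: lp_seq_def ennreal_mult_less_top intro: le_less_trans)
    have "ennreal C1 * Lp_norm (count_space UNIV) p c \<le> ennreal C1 * Lp_norm (count_space UNIV) p ?d"
      by (intro mult_left_mono norms) simp
    then have 1: "ennreal C1 * Lp_norm (count_space UNIV) p c \<le> Lp_norm lborel p (synth ?h ?d)"
      using C(3)[OF d] by (rule order_trans)
    have "Lp_norm lborel p (synth ?h ?d) \<le> ennreal C2 * (ennreal (real N) * Lp_norm (count_space UNIV) p c)"
      by (intro order_trans[OF C(4)[OF d]] mult_left_mono norms) simp
    then have 2: "Lp_norm lborel p (synth ?h ?d) \<le> ennreal (C2 * real N) * Lp_norm (count_space UNIV) p c"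
      using C(2) by (simp add: ennreal_mult mult.assoc)
    show "(\<forall>x. shift_term (alternating_generator N) c x summable_on UNIV) \<and>
       ennreal C1 * Lp_norm (count_space UNIV) p c
         \<le> Lp_norm lborel p (\<lambda>x. \<Sum>\<^sub>\<infinity>n. shift_term (alternating_generator N) c x n) \<and>
       Lp_norm lborel p (\<lambda>x. \<Sum>\<^sub>\<infinity>n. shift_term (alternating_generator N) c x n)
         \<le> ennreal (C2 * real N) * Lp_norm (count_space UNIV) p c"
      unfolding eq using 1 2 shift_series_eq_synth[where c = c, OF N K] has_sum_imp_summable by blast
  qed
qed

section \<open>Zeros of the alternating series\<close>

text \<open>
  The reflection $m \mapsto 2k + 1 - m$ of the nodes about $k + \frac12$ preserves the values of
  $H$ and changes the parity of $m$.
\<close>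

lemma alternating_synth_zero:
  "synth h (\<lambda>m. (-1) powi m) ((of_int k + 1 / 2) * h) = 0"
proof -
  let ?f = "\<lambda>m. (- 1) powi m * complex_of_real (H ((of_int k + 1 / 2) * h - of_int m * h))"
  have "?f (2 * k + 1 - m) = - ?f m" for m
  proof -
    have "(of_int k + 1 / 2) * h - of_int (2 * k + 1 - m) * h = - ((of_int k + 1 / 2) * h - of_int m * h)"
      by (simp add: algebra_simps)
    then have "H ((of_int k + 1 / 2) * h - of_int (2 * k + 1 - m) * h) = H ((of_int k + 1 / 2) * h - of_int m * h)"
      by (simp only: H_minus)
    then show ?thesis by (simp add: power_int_minus_left)
  qed
  then have "infsum ?f UNIV = - infsum ?f UNIV"
    using infsum_int_reflect[of ?f "2 * k + 1"] by (simp add: infsum_uminus)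
  then show ?thesis by (simp add: synth_def)
qed

text \<open>
  The coefficients $c_n = (-1)^{nN}$ interleave to $(-1)^m$. The resulting function does not vanish at
  $0$, where its value is $P_{1/N}(-1)$.
\<close>

lemma half_grid_not_uniqueness_set:
  assumes N: "N > 0"
  shows "\<not> uniqueness_set (range (\<lambda>k::int. (of_int k + 1 / 2) * (1 / real N))) (V_infty (alternating_generator N))"
proof -
  let ?c = "\<lambda>n::int. (-1 :: complex) powi (n * int N)" and ?h = "1 / real N"
  have "interleave N ?c m = (-1) powi m" for m
  proof -
    have "interleave N ?c m = (-1) powi (((m - 1) mod int N + 1) + (m - 1) div int N * int N)"
      unfolding interleave_def by (rule power_int_add[symmetric]) simp
    also have "((m - 1) mod int N + 1) + (m - 1) div int N * int N = m" by simp
    finally show ?thesis .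
  qed
  then have "interleave N ?c = (\<lambda>m. (-1) powi m)" by blast
  then have "(shift_term (alternating_generator N) ?c x has_sum synth ?h (\<lambda>m. (-1) powi m) x) UNIV" for x
    using shift_series_eq_synth[OF N, of ?c 1 x] by (simp add: norm_power_int)
  moreover have "?c \<in> lp_seq \<infinity>"
    by (auto simp: lp_seq_def Lp_norm_def norm_power_int intro!: le_less_trans[OF esssup_I[where c = 1]])
  ultimately have "synth ?h (\<lambda>m. (-1) powi m) \<in> V_infty (alternating_generator N)"
    unfolding V_infty_def by blast
  moreover have "synth ?h (\<lambda>m. (-1) powi m) 0 \<noteq> 0"
    using synth_character[of "-1" ?h 0] grid_symbol_minus_one_nonzero[of ?h] N by simp
  ultimately show ?thesis
    unfolding uniqueness_set_def using alternating_synth_zero[of ?h] by auto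
qed

section \<open>The half-integer grid\<close>

lemma separated_half_grid:
  assumes h: "h > 0"
  shows "separated (range (\<lambda>k::int. (of_int k + 1 / 2) * h))"
proof -
  have "ereal h \<le> (INF x\<in>range (\<lambda>k::int. (of_int k + 1 / 2) * h). INF y\<in>range (\<lambda>k::int. (of_int k + 1 / 2) * h) - {x}. ereal \<bar>x - y\<bar>)"
  proof (intro INF_greatest)
    fix x y assume "x \<in> range (\<lambda>k::int. (of_int k + 1 / 2) * h)" "y \<in> range (\<lambda>k::int. (of_int k + 1 / 2) * h) - {x}"
    then obtain k l :: int where x: "x = (of_int k + 1 / 2) * h" and y: "y = (of_int l + 1 / 2) * h" and "k \<noteq> l" by auto
    then have "1 \<le> \<bar>real_of_int (k - l)\<bar>" by linarith
    then have "h \<le> \<bar>real_of_int (k - l)\<bar> * h" using h by simp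
    also have "\<dots> = \<bar>x - y\<bar>" using h by (simp add: x y abs_mult flip: left_diff_distrib)
    finally show "ereal h \<le> ereal \<bar>x - y\<bar>" by simp
  qed
  then show ?thesis using h by (auto simp: separated_def intro: less_le_trans[of 0 "ereal h"])
qed

text \<open>
  An interval of length $2R/h$ contains $2R/h$ integers up to an error of 1.
\<close>

lemma card_half_grid_window:
  fixes h R x :: real
  assumes h: "h > 0" and R: "R > 0"
  defines "n \<equiv> real (card (range (\<lambda>k::int. (of_int k + 1 / 2) * h) \<inter> {x - R..x + R}))"
  shows "2 * R / h - 1 \<le> n" "n \<le> 2 * R / h + 1"
proof -
  define a where "a = (x - R) / h - 1 / 2"
  define b where "b = (x + R) / h - 1 / 2"
  have "range (\<lambda>k::int. (of_int k + 1 / 2) * h) \<inter> {x - R..x + R} = (\<lambda>k::int. (of_int k + 1 / 2) * h) ` {\<lceil>a\<rceil>..\<lfloor>b\<rfloor>}"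
  proof -
    have "x - R \<le> (of_int k + 1 / 2) * h \<and> (of_int k + 1 / 2) * h \<le> x + R \<longleftrightarrow> \<lceil>a\<rceil> \<le> k \<and> k \<le> \<lfloor>b\<rfloor>" for k :: int
      using h by (simp add: a_def b_def ceiling_le_iff le_floor_iff field_simps)
    then show ?thesis by auto
  qed
  then have "n = real (card ((\<lambda>k::int. (of_int k + 1 / 2) * h) ` {\<lceil>a\<rceil>..\<lfloor>b\<rfloor>}))" by (simp add: n_def)
  also have "\<dots> = real (nat (\<lfloor>b\<rfloor> - \<lceil>a\<rceil> + 1))"
    by (subst card_image) (use h in \<open>auto simp: inj_on_def\<close>)
  finally have n: "n = real (nat (\<lfloor>b\<rfloor> - \<lceil>a\<rceil> + 1))" .
  have "b - a = ((x + R) - (x - R)) / h" by (simp add: a_def b_def flip: diff_divide_distrib)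
  then have ab: "b - a = 2 * R / h" by simp
  have pos: "2 * R / h > 0" using h R by simp
  define z where "z = \<lfloor>b\<rfloor> - \<lceil>a\<rceil> + 1"
  have z: "of_int z = of_int \<lfloor>b\<rfloor> - of_int \<lceil>a\<rceil> + (1 :: real)" by (simp add: z_def)
  have "b < of_int \<lfloor>b\<rfloor> + 1" "of_int \<lfloor>b\<rfloor> \<le> b" "a \<le> of_int \<lceil>a\<rceil>" "of_int \<lceil>a\<rceil> < a + 1"
    by linarith+
  then have lo: "2 * R / h - 1 \<le> of_int z" and hi: "of_int z \<le> 2 * R / h + 1"
    using z ab by argo+
  have "(- 1 :: real) < of_int z" using lo pos by argo
  then have "z \<ge> 0" by simp
  then have "n = of_int z" unfolding n z_def[symmetric] by (rule of_nat_nat)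
  then show "2 * R / h - 1 \<le> n" "n \<le> 2 * R / h + 1" using lo hi by argo+
qed

lemma lower_density_half_grid:
  assumes h: "h > 0"
  shows "has_lower_density (range (\<lambda>k::int. (of_int k + 1 / 2) * h)) (1 / h)"
proof -
  let ?L = "range (\<lambda>k::int. (of_int k + 1 / 2) * h)"
  let ?q = "\<lambda>R x. real (card (?L \<inter> {x - R..x + R})) / (2 * R)"
  have bounds: "1 / h - inverse R / 2 \<le> (INF x. ?q R x) \<and> (INF x. ?q R x) \<le> 1 / h + inverse R / 2" if R: "R > 0" for R
  proof -
    have "(2 * R / h - 1) / (2 * R) = 1 / h - inverse R / 2" "(2 * R / h + 1) / (2 * R) = 1 / h + inverse R / 2"
      using h R by (simp_all add: field_simps)
    then have lo: "1 / h - inverse R / 2 \<le> ?q R x" and hi: "?q R x \<le> 1 / h + inverse R / 2" for x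
      using divide_right_mono[OF card_half_grid_window(1)[OF h R, of x], of "2 * R"]
        divide_right_mono[OF card_half_grid_window(2)[OF h R, of x], of "2 * R"] R by simp_all
    have "(INF x. ?q R x) \<le> ?q R 0"
      by (intro cINF_lower bdd_belowI2[OF lo]) auto
    then show ?thesis using hi[of 0] lo by (auto intro: cINF_greatest)
  qed
  have inv: "((\<lambda>R::real. inverse R) \<longlongrightarrow> 0) at_top" by (rule tendsto_inverse_0_at_top[OF filterlim_ident])
  show ?thesis
    unfolding has_lower_density_def
  proof (rule tendsto_sandwich)
    show "\<forall>\<^sub>F R in at_top. 1 / h - inverse R / 2 \<le> (INF x. ?q R x)"
      using eventually_gt_at_top[of 0] by eventually_elim (use bounds in blast)
    show "\<forall>\<^sub>F R in at_top. (INF x. ?q R x) \<le> 1 / h + inverse R / 2"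
      using eventually_gt_at_top[of 0] by eventually_elim (use bounds in blast)
    show "((\<lambda>R. 1 / h - inverse R / 2) \<longlongrightarrow> 1 / h) at_top" "((\<lambda>R. 1 / h + inverse R / 2) \<longlongrightarrow> 1 / h) at_top"
      using tendsto_diff[OF tendsto_const[of "1 / h"] tendsto_divide[OF inv tendsto_const[of 2]]]
        tendsto_add[OF tendsto_const[of "1 / h"] tendsto_divide[OF inv tendsto_const[of 2]]] by simp_all
  qed
qed

section \<open>Stable generators with a non-uniqueness set of density $N$\<close>

theorem theorem1p10:
  fixes N :: nat
  assumes "N \<ge> 2"
  shows "\<exists>(a :: nat \<Rightarrow> real) (b :: nat \<Rightarrow> real) (\<Lambda> :: real set) (G :: real \<Rightarrow> real).
    (\<forall>j\<in>{1..N}. b j > 0) \<and>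
    separated \<Lambda> \<and> has_lower_density \<Lambda> (real N) \<and>
    (\<forall>x. G x = (\<Sum>j=1..N. a j * H (x - b j))) \<and>
    (\<forall>x. G x = (\<Sum>j=1..N. a j * exp (b j) * (exp x / (exp (2 * x) + exp (2 * b j))))) \<and>
    stable_shifts G \<and>
    \<not> uniqueness_set \<Lambda> (V_infty G)"
proof -
  have N: "N > 0" using assms by simp
  let ?\<Lambda> = "range (\<lambda>k::int. (of_int k + 1 / 2) * (1 / real N))"
  show ?thesis
  proof (intro exI conjI)
    show "\<forall>j\<in>{1..N}. (\<lambda>j. real j / real N) j > 0" using N by simp
    show "separated ?\<Lambda>" by (rule separated_half_grid) (use N in simp)
    show "has_lower_density ?\<Lambda> (real N)" using lower_density_half_grid[of "1 / real N"] N by simp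
    show G: "\<forall>x. alternating_generator N x = (\<Sum>j=1..N. (-1) ^ j * H (x - real j / real N))"
      by (simp add: alternating_generator_def)
    show "\<forall>x. alternating_generator N x = (\<Sum>j=1..N. (-1) ^ j * exp (real j / real N) * (exp x / (exp (2 * x) + exp (2 * (real j / real N)))))"
      unfolding alternating_generator_def H_shift_eq by (simp add: mult.assoc)
    show "stable_shifts (alternating_generator N)" by (rule alternating_generator_stable[OF N])
    show "\<not> uniqueness_set ?\<Lambda> (V_infty (alternating_generator N))" by (rule half_grid_not_uniqueness_set[OF N])
  qed
qed

end
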